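(* Let $p_i\in(0,1)$ for $i\in\mathbb Z$, and consider the nearest neighbor exclusion process on $\{0,1\}^{\mathbb Z}$ with jump probabilities $p_i$ (from $i$ to $i+1$) and $q_i=1-p_i$ (from $i$ to $i-1$). Suppose that for every $\epsilon>0$ and every positive integer $n$ there exist $k,l\in\mathbb Z$ such that $p_i\ge\frac12-\epsilon$ for all $k\le i\le k+n$ and $p_i\le\frac12+\epsilon$ for all $l\le i\le l+n$. Then every $\mu\in\mathcal I$ is reversible.
   Context: The exclusion process is the continuous time Markov (Feller) process $\eta_t$ on $\{0,1\}^{\mathbb Z}$ (product topology) whose generator acts on functions $f$ depending on finitely many coordinates by $$\mathcal L f(\eta)=\sum_{i\in\mathbb Z}\Big\{\eta(i)[1-\eta(i+1)]p_i+\eta(i+1)[1-\eta(i)]q_{i+1}\Big\}[f(\eta_{i,i+1})-f(\eta)],$$ where $\eta_{i,i+1}$ is obtained from $\eta$ by interchanging the $i$th and $(i+1)$st coordinates. $\mathcal I$ is the set of all stationary distributions of the process (probability measures on $\{0,1\}^{\mathbb Z}$ invariant under its evolution). A stationary distribution $\mu$ is reversible if $\int f\,S(t)g\,d\mu=\int g\,S(t)f\,d\mu$ for all continuous $f,g$ and $t\ge0$, where $S(t)$ is the semigroup of the process; equivalently $\int f\,\mathcal Lg\,d\mu=\int g\,\mathcal Lf\,d\mu$ for all $f,g$ depending on finitely many coordinates. *)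

theory Defs
  imports "HOL-Probability.Probability"
begin

text \<open>
  The configuration space is \<^typ>\<open>int \<Rightarrow> bool\<close>, where \<^typ>\<open>bool\<close> carries the discrete topology
  and the function type the product topology, and site \<open>i\<close> is occupied iff \<open>\<eta> i\<close>.  This space
  is compact, so \<open>(int \<Rightarrow> bool) \<Rightarrow>\<^sub>C real\<close> is the Banach space of all continuous functions on
  it with the supremum norm.
\<close>

type_synonym config = "int \<Rightarrow> bool"

definition markov_semigroup :: "(real \<Rightarrow> ('a::topological_space \<Rightarrow>\<^sub>C real) \<Rightarrow> ('a \<Rightarrow>\<^sub>C real)) \<Rightarrow> bool" where
  "markov_semigroup S \<longleftrightarrow>
     (\<forall>t\<ge>0. linear (S t)) \<and>
     (\<forall>f. S 0 f = f) \<and>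
     (\<forall>s\<ge>0. \<forall>t\<ge>0. \<forall>f. S (s + t) f = S s (S t f)) \<and>
     (\<forall>t\<ge>0. S t (const_bcontfun 1) = const_bcontfun 1) \<and>
     (\<forall>t\<ge>0. \<forall>f. (\<forall>x. 0 \<le> apply_bcontfun f x) \<longrightarrow> (\<forall>x. 0 \<le> apply_bcontfun (S t f) x)) \<and>
     (\<forall>f. ((\<lambda>t. S t f) \<longlongrightarrow> f) (at_right 0))"

text \<open>The graph of the infinitesimal generator; the limit is in the supremum norm.\<close>

definition generator_graph ::
  "(real \<Rightarrow> ('a::topological_space \<Rightarrow>\<^sub>C real) \<Rightarrow> ('a \<Rightarrow>\<^sub>C real)) \<Rightarrow> (('a \<Rightarrow>\<^sub>C real) \<times> ('a \<Rightarrow>\<^sub>C real)) set" where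
  "generator_graph S = {(f, g). ((\<lambda>t. (1 / t) *\<^sub>R (S t f - f)) \<longlongrightarrow> g) (at_right 0)}"

definition finitely_dependent :: "(config \<Rightarrow> real) \<Rightarrow> bool" where
  "finitely_dependent f \<longleftrightarrow>
     (\<exists>A. finite A \<and> (\<forall>\<eta> \<zeta>. (\<forall>i\<in>A. \<eta> i = \<zeta> i) \<longrightarrow> f \<eta> = f \<zeta>))"

definition swap_sites :: "config \<Rightarrow> int \<Rightarrow> config" where
  "swap_sites \<eta> i = \<eta>(i := \<eta> (i + 1), i + 1 := \<eta> i)"

text \<open>
  For finitely dependent \<open>f\<close> only finitely many summands are nonzero, so the sum over \<open>\<int>\<close> is
  a finite one.
\<close>

definition exclusion_generator :: "(int \<Rightarrow> real) \<Rightarrow> (int \<Rightarrow> real) \<Rightarrow> (config \<Rightarrow> real) \<Rightarrow> config \<Rightarrow> real" where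
  "exclusion_generator p q f \<eta> =
     (\<Sum>\<^sub>\<infinity>i\<in>UNIV.
        (of_bool (\<eta> i) * (1 - of_bool (\<eta> (i + 1))) * p i
         + of_bool (\<eta> (i + 1)) * (1 - of_bool (\<eta> i)) * q (i + 1))
        * (f (swap_sites \<eta> i) - f \<eta>))"

text \<open>
  \<open>S\<close> is the semigroup of the exclusion process: a Markov (Feller) semigroup such that every
  finitely dependent function is in the domain of its generator, which acts on it as above.
  For bounded nonnegative rates there is exactly one such semigroup.
\<close>

definition exclusion_semigroup ::
  "(int \<Rightarrow> real) \<Rightarrow> (int \<Rightarrow> real) \<Rightarrow> (real \<Rightarrow> (config \<Rightarrow>\<^sub>C real) \<Rightarrow> (config \<Rightarrow>\<^sub>C real)) \<Rightarrow> bool" where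
  "exclusion_semigroup p q S \<longleftrightarrow>
     markov_semigroup S \<and>
     (\<forall>f. finitely_dependent (apply_bcontfun f) \<longrightarrow>
        (\<exists>g. apply_bcontfun g = exclusion_generator p q (apply_bcontfun f) \<and> (f, g) \<in> generator_graph S))"

definition stationary_distributions ::
  "(real \<Rightarrow> ('a::topological_space \<Rightarrow>\<^sub>C real) \<Rightarrow> ('a \<Rightarrow>\<^sub>C real)) \<Rightarrow> 'a measure set" where
  "stationary_distributions S =
     {\<mu>. prob_space \<mu> \<and> sets \<mu> = sets borel \<and>
        (\<forall>t\<ge>0. \<forall>f. (\<integral>\<eta>. apply_bcontfun (S t f) \<eta> \<partial>\<mu>) = (\<integral>\<eta>. apply_bcontfun f \<eta> \<partial>\<mu>))}"

definition reversible ::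
  "(real \<Rightarrow> ('a::topological_space \<Rightarrow>\<^sub>C real) \<Rightarrow> ('a \<Rightarrow>\<^sub>C real)) \<Rightarrow> 'a measure \<Rightarrow> bool" where
  "reversible S \<mu> \<longleftrightarrow>
     \<mu> \<in> stationary_distributions S \<and>
     (\<forall>t\<ge>0. \<forall>f g. (\<integral>\<eta>. apply_bcontfun f \<eta> * apply_bcontfun (S t g) \<eta> \<partial>\<mu>)
                  = (\<integral>\<eta>. apply_bcontfun g \<eta> * apply_bcontfun (S t f) \<eta> \<partial>\<mu>))"

end

theory Submission
  imports Defs
begin

text \<open>
  The proof rests on the current of a stationary measure \<open>\<mu>\<close>, the net flow of particles per unit
  time across a bond.  Stationarity tested on \<open>\<eta> i\<close> says that the current is the same across all
  bonds (\<open>current_const\<close>).  Where \<open>p\<close> is at most \<open>1/2 + \<epsilon>\<close> the current across \<open>{i, i + 1}\<close> is at most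
  half of the density difference between \<open>i\<close> and \<open>i + 1\<close>, up to \<open>\<epsilon>\<close>; summed over a stretch of \<open>n\<close>
  bonds the densities telescope and the current is at most \<open>1/(2n) + \<epsilon>\<close>.  With the symmetric bound
  for stretches where \<open>p\<close> is at least \<open>1/2 - \<epsilon>\<close>, the hypothesis makes the current vanish.

  A stationary measure without current satisfies detailed balance, by an entropy argument.  Let
  \<open>\<pi>\<close> be a positive solution of \<open>\<pi> i * p i = \<pi> (i + 1) * q (i + 1)\<close>, so that the product weights of
  \<open>\<pi>\<close> are reversible, and let \<open>h\<close> be the density of the marginal of \<open>\<mu>\<close> on a box with respect to
  these weights.  Stationarity tested on \<open>ln h\<close> equates a sum of terms \<open>(a - b) * (ln a - ln b)\<close>,
  where \<open>a\<close> and \<open>b\<close> are the flows over an interior bond in the two directions, with two boundary terms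
  (\<open>entropy_balance\<close>).  In a boundary term the weight \<open>\<pi>\<close> of the end site contributes
  \<open>ln \<pi>\<close> times the current, which is zero.  What is left is bounded by an absolute constant, and
  also by \<open>d / (2 * k) + k\<close> for every \<open>k > 0\<close>, where \<open>d\<close> is the dissipation over that boundary bond
  (\<open>boundary_term_le\<close>).  Neither bound involves the rates or the size of the box.
  So the total interior dissipation \<open>D n\<close> of \<open>box n\<close> is bounded in \<open>n\<close>.  By the log sum inequality the
  dissipation over a bond does not decrease when the box grows, so \<open>D (n + 1) - D n\<close> dominates the
  two boundary dissipations of \<open>box n\<close>, which therefore tend to zero; hence \<open>D n \<le> 2 * k\<close> for every
  \<open>k > 0\<close>, that is \<open>D n = 0\<close>, and this is detailed balance (\<open>detailed_balance\<close>).  The scheme is that of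
  the theorem of Holley and Stroock on reversible spin systems in low dimension.

  Detailed balance makes the generator symmetric on functions of finitely many sites.  For such \<open>f\<close>
  the norm of \<open>L^n f\<close> grows at most like \<open>C * 8^n * n!\<close>, so \<open>S t f\<close> is the sum of its Taylor series for
  \<open>t < 1/8\<close> and the symmetry passes to \<open>S t\<close>; density and the semigroup property extend it to all
  continuous functions and all times (\<open>symmetric_generator_imp_reversible\<close>).
\<close>

section \<open>The dissipation of a pair of opposite flows\<close>

lemma sq_le_two_exp: "z\<^sup>2 \<le> 2 * exp (z::real)" if "0 \<le> z"
proof -
  have "1 + z + z\<^sup>2 / 2 \<le> exp z" using exp_lower_Taylor_quadratic[OF that] .
  then show ?thesis using that by linarith
qed

text \<open>
  The entropy production of a bond with flows \<open>a\<close> and \<open>b\<close> in the two directions.  With the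
  convention \<open>ln 0 = 0\<close> it vanishes when both flows do; flows with exactly one of them zero
  do not occur for stationary measures, and the lemmas exclude them.
\<close>

definition bond_dissipation :: "real \<Rightarrow> real \<Rightarrow> real" where
  "bond_dissipation a b = (a - b) * (ln a - ln b)"

text \<open>
  The function \<open>bond_dissipation\<close> is convex and homogeneous of degree one, so it lies above its
  supporting planes; the right-hand side is the plane that touches it along the ray \<open>a = b * r\<close>.
\<close>

lemma bond_dissipation_ge:
  fixes a b r :: real
  assumes "0 < a" "0 < b" "0 < r"
  shows "(a - b) * ln r + a - b * r + b - a / r \<le> bond_dissipation a b"
proof -
  have "ln (b * r / a) \<le> b * r / a - 1" using assms by (intro ln_le_minus_one) auto
  then have 1: "ln b + ln r - ln a \<le> b * r / a - 1"
    using assms by (simp add: ln_mult ln_div)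
  have 1: "a * (ln b + ln r - ln a) \<le> b * r - a"
    using mult_left_mono[OF 1, of a] assms by (simp add: right_diff_distrib)
  have "ln (a / (b * r)) \<le> a / (b * r) - 1" using assms by (intro ln_le_minus_one) auto
  then have 2: "ln a - ln b - ln r \<le> a / (b * r) - 1"
    using assms by (simp add: ln_mult ln_div)
  have 2: "b * (ln a - ln b - ln r) \<le> a / r - b"
    using mult_left_mono[OF 2, of b] assms by (simp add: right_diff_distrib)
  show ?thesis
    unfolding bond_dissipation_def using 1 2 by (simp add: algebra_simps)
qed

lemma bond_dissipation_nonneg:
  assumes "0 \<le> a" "0 \<le> b" "a = 0 \<longleftrightarrow> b = 0"
  shows "0 \<le> bond_dissipation a b"
proof (cases "a = 0")
  case False
  then have "0 < a" "0 < b" using assms by auto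
  then show ?thesis
    unfolding bond_dissipation_def
    by (cases "a \<le> b") (auto intro: mult_nonneg_nonneg mult_nonpos_nonpos)
qed (use assms in \<open>auto simp: bond_dissipation_def\<close>)

lemma bond_dissipation_eq_0:
  assumes "0 \<le> a" "0 \<le> b" "a = 0 \<longleftrightarrow> b = 0" "bond_dissipation a b = 0"
  shows "a = b"
  using assms by (auto simp: bond_dissipation_def)

text \<open>
  The log sum inequality: a coarser description of the configuration shows less dissipation.
  Add the supporting planes for the common ratio \<open>r = (a + c) / (b + d)\<close>.
\<close>

lemma bond_dissipation_add:
  assumes "0 \<le> a" "0 \<le> b" "a = 0 \<longleftrightarrow> b = 0" "0 \<le> c" "0 \<le> d" "c = 0 \<longleftrightarrow> d = 0"
  shows "bond_dissipation (a + c) (b + d) \<le> bond_dissipation a b + bond_dissipation c d"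
proof (cases "a = 0 \<or> c = 0")
  case True
  then show ?thesis using assms by (auto simp: bond_dissipation_def)
next
  case False
  then have pos: "0 < a" "0 < b" "0 < c" "0 < d" using assms by auto
  define r where "r = (a + c) / (b + d)"
  have r: "0 < r" using pos by (simp add: r_def)
  have lnr: "ln r = ln (a + c) - ln (b + d)" using pos by (simp add: r_def ln_div)
  have rr: "(b + d) * r = a + c" "(a + c) / r = b + d" using pos by (simp_all add: r_def)
  have "bond_dissipation (a + c) (b + d)
      = ((a - b) * ln r + a - b * r + b - a / r) + ((c - d) * ln r + c - d * r + d - c / r)"
    using rr unfolding bond_dissipation_def lnr[symmetric]
    by (simp add: algebra_simps add_divide_distrib)
  also have "\<dots> \<le> bond_dissipation a b + bond_dissipation c d"
    by (intro add_mono bond_dissipation_ge pos r)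
  finally show ?thesis .
qed

text \<open>
  A configuration of the box with mass \<open>t\<close> loses the flow \<open>a\<close> to one with mass \<open>s\<close>, against a
  reverse flow \<open>b\<close>, which is the smaller one.  Since \<open>a \<le> t\<close>, the mass \<open>t\<close> may be replaced by \<open>a\<close>,
  which leaves \<open>(a - b) * z\<close> with \<open>z = ln (s / a)\<close>.  Only \<open>z > 0\<close> matters, and then
  \<open>a = s * exp (- z)\<close> shows that both \<open>a * z\<close> and \<open>a * z\<^sup>2 / 2\<close> are at most \<open>s\<close>, while
  \<open>(a - b)\<^sup>2 / a\<close> is at most the dissipation.  The arithmetic-geometric mean inequality with
  weight \<open>k\<close> combines the two.
\<close>

lemma boundary_flow_le_aux:
  fixes a b s t :: real
  assumes b: "0 < b" "b \<le> a" and a: "a \<le> t" and s: "0 < s" and k: "0 < k"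
  shows "(a - b) * (ln s - ln t) \<le> bond_dissipation a b / (2 * k) + k * s"
    and "(a - b) * (ln s - ln t) \<le> s"
proof -
  define z where "z = ln s - ln a"
  have apos: "0 < a" using b by simp
  have lt: "ln a \<le> ln t" using apos a by simp
  have le: "(a - b) * (ln s - ln t) \<le> (a - b) * z"
    using b lt unfolding z_def by (intro mult_left_mono) auto
  have d0: "0 \<le> bond_dissipation a b" using b by (intro bond_dissipation_nonneg) auto
  have sz: "s = a * exp z" using s apos by (simp add: z_def exp_diff)
  have "(a - b) * z \<le> bond_dissipation a b / (2 * k) + k * s \<and> (a - b) * z \<le> s"
  proof (cases "z \<le> 0")
    case True
    have "(a - b) * z \<le> 0" using True b by (simp add: mult_nonneg_nonpos)
    moreover have "0 \<le> bond_dissipation a b / (2 * k)" "0 \<le> k * s" using d0 k s by auto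
    ultimately show ?thesis using s by linarith
  next
    case False
    then have z: "0 \<le> z" by simp
    have "ln (b / a) \<le> b / a - 1" using b apos by (intro ln_le_minus_one) auto
    then have "(a - b) / a \<le> ln a - ln b"
      using b apos by (simp add: ln_div diff_divide_distrib)
    then have sq: "(a - b) * ((a - b) / a) \<le> bond_dissipation a b"
      unfolding bond_dissipation_def using b by (intro mult_left_mono) auto
    define u where "u = (a - b) / a"
    have u: "a - b = a * u" using apos by (simp add: u_def)
    have sq: "a * u\<^sup>2 \<le> bond_dissipation a b" using sq apos unfolding u_def[symmetric] u
      by (simp add: power2_eq_square ac_simps)
    have am: "2 * (u * (k * z)) \<le> u\<^sup>2 + (k * z)\<^sup>2"
      using sum_squares_bound[of u "k * z"] by simp
    have "(a - b) * z = a * (2 * (u * (k * z))) / (2 * k)" using k by (simp add: u field_simps)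
    also have "\<dots> \<le> a * (u\<^sup>2 + (k * z)\<^sup>2) / (2 * k)"
      using am apos k by (intro divide_right_mono mult_left_mono) auto
    also have "\<dots> = a * u\<^sup>2 / (2 * k) + k * (a * (z\<^sup>2 / 2))"
      using k by (simp add: field_simps power2_eq_square)
    also have "\<dots> \<le> bond_dissipation a b / (2 * k) + k * (a * exp z)"
      using sq sq_le_two_exp[OF z] k apos
      by (intro add_mono divide_right_mono mult_left_mono) auto
    finally have 1: "(a - b) * z \<le> bond_dissipation a b / (2 * k) + k * s" by (simp add: sz)
    have zexp: "z \<le> exp z" using exp_ge_add_one_self[of z] by linarith
    have "(a - b) * z \<le> a * exp z"
      using b z zexp by (intro mult_mono) auto
    then show ?thesis using 1 by (simp add: sz)
  qed
  then show "(a - b) * (ln s - ln t) \<le> bond_dissipation a b / (2 * k) + k * s"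
    and "(a - b) * (ln s - ln t) \<le> s" using le by linarith+
qed

lemma boundary_flow_le:
  fixes a b s t :: real
  assumes ab: "0 \<le> a" "0 \<le> b" "a = 0 \<longleftrightarrow> b = 0" and "a \<le> t" "b \<le> s" and k: "0 < k"
  shows "(a - b) * (ln s - ln t) \<le> bond_dissipation a b / (2 * k) + k * (s + t)"
    and "(a - b) * (ln s - ln t) \<le> s + t"
proof -
  have "(a - b) * (ln s - ln t) \<le> bond_dissipation a b / (2 * k) + k * (s + t)
      \<and> (a - b) * (ln s - ln t) \<le> s + t"
  proof (cases "a = 0")
    case True
    then show ?thesis using assms by (auto simp: bond_dissipation_def)
  next
    case False
    then have pos: "0 < a" "0 < b" "0 < s" "0 < t" using assms by auto
    have mono: "k * s \<le> k * (s + t)" "k * t \<le> k * (s + t)" using pos k by auto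
    show ?thesis
    proof (cases "b \<le> a")
      case True
      show ?thesis
        using boundary_flow_le_aux[OF pos(2) True \<open>a \<le> t\<close> pos(3) k] mono pos by linarith
    next
      case False
      then have "a \<le> b" by simp
      have eq: "(a - b) * (ln s - ln t) = (b - a) * (ln t - ln s)"
        "bond_dissipation a b = bond_dissipation b a"
        by (simp_all add: bond_dissipation_def algebra_simps)
      show ?thesis
        using boundary_flow_le_aux[OF pos(1) \<open>a \<le> b\<close> \<open>b \<le> s\<close> pos(4) k] mono pos unfolding eq
        by linarith
    qed
  qed
  then show "(a - b) * (ln s - ln t) \<le> bond_dissipation a b / (2 * k) + k * (s + t)"
    and "(a - b) * (ln s - ln t) \<le> s + t" by auto
qed

section \<open>Functions of finitely many sites\<close>

definition depends_on :: "int set \<Rightarrow> (config \<Rightarrow> real) \<Rightarrow> bool" where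
  "depends_on \<Lambda> f \<longleftrightarrow> (\<forall>\<eta> \<zeta>. (\<forall>i\<in>\<Lambda>. \<eta> i = \<zeta> i) \<longrightarrow> f \<eta> = f \<zeta>)"

lemma depends_onD: "depends_on \<Lambda> f \<Longrightarrow> (\<And>i. i \<in> \<Lambda> \<Longrightarrow> \<eta> i = \<zeta> i) \<Longrightarrow> f \<eta> = f \<zeta>"
  by (auto simp: depends_on_def)

lemma depends_on_mono: "depends_on \<Lambda> f \<Longrightarrow> \<Lambda> \<subseteq> \<Lambda>' \<Longrightarrow> depends_on \<Lambda>' f"
proof -
  assume f: "depends_on \<Lambda> f" and sub: "\<Lambda> \<subseteq> \<Lambda>'"
  show "depends_on \<Lambda>' f"
    unfolding depends_on_def
  proof (intro allI impI)
    fix \<eta> \<zeta> :: config assume "\<forall>i\<in>\<Lambda>'. \<eta> i = \<zeta> i"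
    then show "f \<eta> = f \<zeta>" using sub by (intro depends_onD[OF f]) auto
  qed
qed

lemma finitely_dependent_iff: "finitely_dependent f \<longleftrightarrow> (\<exists>\<Lambda>. finite \<Lambda> \<and> depends_on \<Lambda> f)"
  by (simp add: finitely_dependent_def depends_on_def)

text \<open>
  A configuration on \<open>\<Lambda>\<close> is encoded by the set \<open>x\<close> of its occupied sites, so the configurations
  on \<open>\<Lambda>\<close> are the elements of \<open>Pow \<Lambda>\<close>; for other \<open>x\<close> the cylinder is empty.
\<close>

definition cylinder :: "int set \<Rightarrow> int set \<Rightarrow> config set" where
  "cylinder \<Lambda> x = {\<eta>. {i\<in>\<Lambda>. \<eta> i} = x}"

abbreviation config_of :: "int set \<Rightarrow> config" where
  "config_of x \<equiv> (\<lambda>i. i \<in> x)"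

lemma swap_sites_apply:
  "swap_sites \<eta> i j = (if j = i then \<eta> (i + 1) else if j = i + 1 then \<eta> i else \<eta> j)"
  by (simp add: swap_sites_def)

lemma swap_config_of:
  assumes "i \<notin> x" "i + 1 \<notin> x"
  shows "swap_sites (config_of (insert i x)) i = config_of (insert (i + 1) x)"
    and "swap_sites (config_of (insert (i + 1) x)) i = config_of (insert i x)"
  using assms by (auto simp: swap_sites_apply fun_eq_iff)

definition bond_rate :: "(int \<Rightarrow> real) \<Rightarrow> (int \<Rightarrow> real) \<Rightarrow> int \<Rightarrow> config \<Rightarrow> real" where
  "bond_rate p q i \<eta> = of_bool (\<eta> i) * (1 - of_bool (\<eta> (i + 1))) * p i
                     + of_bool (\<eta> (i + 1)) * (1 - of_bool (\<eta> i)) * q (i + 1)"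

lemma bond_rate_bounds:
  assumes "\<And>i. 0 \<le> p i \<and> p i \<le> 1" "\<And>i. 0 \<le> q i \<and> q i \<le> 1"
  shows "0 \<le> bond_rate p q i \<eta>" "bond_rate p q i \<eta> \<le> 1"
  using assms by (auto simp: bond_rate_def)

definition bonds :: "int set \<Rightarrow> int set" where
  "bonds \<Lambda> = {i. i \<in> \<Lambda> \<or> i + 1 \<in> \<Lambda>}"

lemma bonds_eq: "bonds \<Lambda> = \<Lambda> \<union> (\<lambda>i. i - 1) ` \<Lambda>"
  by (force simp: bonds_def image_iff algebra_simps)

lemma finite_bonds [simp]: "finite \<Lambda> \<Longrightarrow> finite (bonds \<Lambda>)"
  by (simp add: bonds_eq)

lemma exclusion_generator_eq_sum:
  assumes "finite \<Lambda>" "depends_on \<Lambda> f"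
  shows "exclusion_generator p q f \<eta>
           = (\<Sum>i\<in>bonds \<Lambda>. bond_rate p q i \<eta> * (f (swap_sites \<eta> i) - f \<eta>))"
proof -
  have "exclusion_generator p q f \<eta>
      = (\<Sum>\<^sub>\<infinity>i\<in>bonds \<Lambda>. bond_rate p q i \<eta> * (f (swap_sites \<eta> i) - f \<eta>))"
    unfolding exclusion_generator_def bond_rate_def[symmetric]
  proof (rule infsum_cong_neutral)
    fix i assume "i \<in> UNIV - bonds \<Lambda>"
    then have "f (swap_sites \<eta> i) = f \<eta>"
      by (intro depends_onD[OF assms(2)]) (auto simp: bonds_def swap_sites_apply)
    then show "bond_rate p q i \<eta> * (f (swap_sites \<eta> i) - f \<eta>) = 0" by simp
  qed auto
  then show ?thesis using assms(1) by simp
qed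

lemma depends_on_bond_rate: "{i, i + 1} \<subseteq> \<Lambda> \<Longrightarrow> depends_on \<Lambda> (bond_rate p q i)"
  by (auto simp: depends_on_def bond_rate_def)

lemma depends_on_swap_sites:
  "depends_on \<Lambda> f \<Longrightarrow> {i, i + 1} \<subseteq> \<Lambda> \<Longrightarrow> depends_on \<Lambda> (\<lambda>\<eta>. f (swap_sites \<eta> i))"
proof -
  assume f: "depends_on \<Lambda> f" and i: "{i, i + 1} \<subseteq> \<Lambda>"
  show "depends_on \<Lambda> (\<lambda>\<eta>. f (swap_sites \<eta> i))"
    unfolding depends_on_def
  proof (intro allI impI)
    fix \<eta> \<zeta> :: config assume "\<forall>i\<in>\<Lambda>. \<eta> i = \<zeta> i"
    then show "f (swap_sites \<eta> i) = f (swap_sites \<zeta> i)"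
      using i by (intro depends_onD[OF f]) (auto simp: swap_sites_apply)
  qed
qed

lemma depends_on_mult:
  "depends_on \<Lambda> f \<Longrightarrow> depends_on \<Lambda> g \<Longrightarrow> depends_on \<Lambda> (\<lambda>\<eta>. f \<eta> * g \<eta>)"
  by (auto simp: depends_on_def intro!: arg_cong2[where f = "(*)"])

lemma depends_on_diff:
  "depends_on \<Lambda> f \<Longrightarrow> depends_on \<Lambda> g \<Longrightarrow> depends_on \<Lambda> (\<lambda>\<eta>. f \<eta> - g \<eta>)"
  by (auto simp: depends_on_def intro!: arg_cong2[where f = "(-)"])

lemma depends_on_sum: "(\<And>i. i \<in> I \<Longrightarrow> depends_on \<Lambda> (f i)) \<Longrightarrow> depends_on \<Lambda> (\<lambda>\<eta>. \<Sum>i\<in>I. f i \<eta>)"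
  unfolding depends_on_def by (intro allI impI sum.cong refl) blast

lemma sum_Pow_insert:
  fixes h :: "'a set \<Rightarrow> real"
  assumes "finite A" "a \<notin> A"
  shows "(\<Sum>x\<in>Pow (insert a A). h x) = (\<Sum>x\<in>Pow A. h x + h (insert a x))"
proof -
  have inj: "inj_on (insert a) (Pow A)" using assms(2) by (auto simp: inj_on_def)
  have "(\<Sum>x\<in>Pow (insert a A). h x) = (\<Sum>x\<in>Pow A. h x) + (\<Sum>x\<in>insert a ` Pow A. h x)"
    unfolding Pow_insert using assms by (intro sum.union_disjoint) auto
  also have "(\<Sum>x\<in>insert a ` Pow A. h x) = (\<Sum>x\<in>Pow A. h (insert a x))"
    by (simp add: sum.reindex[OF inj])
  finally show ?thesis by (simp add: sum.distrib)
qed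

text \<open>
  A particle crosses a bond only if exactly one of its two sites is occupied, so sums that carry
  a factor \<open>bond_rate\<close> reduce to sums over the configurations \<open>x\<close> off the bond.
\<close>

lemma sum_Pow_bond:
  fixes h :: "int set \<Rightarrow> real"
  assumes "finite \<Lambda>" "{i, i + 1} \<subseteq> \<Lambda>"
    and "\<And>x. x \<subseteq> \<Lambda> - {i, i + 1} \<Longrightarrow> h x = 0"
    and "\<And>x. x \<subseteq> \<Lambda> - {i, i + 1} \<Longrightarrow> h (insert i (insert (i + 1) x)) = 0"
  shows "(\<Sum>x\<in>Pow \<Lambda>. h x) = (\<Sum>x\<in>Pow (\<Lambda> - {i, i + 1}). h (insert i x) + h (insert (i + 1) x))"
proof -
  define A where "A = \<Lambda> - {i, i + 1}"
  have \<Lambda>: "\<Lambda> = insert (i + 1) (insert i A)" using assms(2) by (auto simp: A_def)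
  have fin: "finite A" "i \<notin> A" "i + 1 \<notin> insert i A" using assms(1) by (auto simp: A_def)
  have "(\<Sum>x\<in>Pow \<Lambda>. h x)
      = (\<Sum>x\<in>Pow A. h x + h (insert (i + 1) x) + (h (insert i x) + h (insert (i + 1) (insert i x))))"
    using fin unfolding \<Lambda> by (simp add: sum_Pow_insert[of "insert i A"] sum_Pow_insert[of A i])
  also have "\<dots> = (\<Sum>x\<in>Pow A. h (insert i x) + h (insert (i + 1) x))"
    using assms(3,4) by (intro sum.cong) (auto simp: A_def insert_commute)
  finally show ?thesis by (simp add: A_def)
qed

lemma open_site: "open {\<eta>::config. \<eta> i = b}"
proof -
  have "continuous_on UNIV (\<lambda>\<eta>::config. \<eta> i)" by (rule continuous_on_product_coordinates)
  then have "open ((\<lambda>\<eta>::config. \<eta> i) -` {b})"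
    by (intro open_vimage) (auto intro: discrete_topology_class.open_discrete)
  then show ?thesis by (simp add: vimage_def)
qed

lemma open_agree:
  assumes "finite \<Lambda>" shows "open {\<zeta>::config. \<forall>i\<in>\<Lambda>. \<zeta> i = \<eta> i}"
proof -
  have "{\<zeta>::config. \<forall>i\<in>\<Lambda>. \<zeta> i = \<eta> i} = (\<Inter>i\<in>\<Lambda>. {\<zeta>. \<zeta> i = \<eta> i})" by auto
  then show ?thesis using assms open_site by (auto intro: open_INT)
qed

lemma open_cylinder:
  assumes "finite \<Lambda>" shows "open (cylinder \<Lambda> x)"
proof (cases "x \<subseteq> \<Lambda>")
  case True
  then have "cylinder \<Lambda> x = {\<zeta>. \<forall>i\<in>\<Lambda>. \<zeta> i = config_of x i}" by (auto simp: cylinder_def)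
  then show ?thesis using open_agree[OF assms, of "config_of x"] by simp
next
  case False
  then have "cylinder \<Lambda> x = {}" by (auto simp: cylinder_def)
  then show ?thesis by simp
qed

lemma depends_on_continuous:
  assumes "finite \<Lambda>" "depends_on \<Lambda> f" shows "continuous_on UNIV f"
  unfolding continuous_on_topological
proof (intro ballI allI impI)
  fix \<eta> B assume B: "f \<eta> \<in> B"
  have "f \<zeta> \<in> B" if "\<zeta> \<in> {\<zeta>. \<forall>i\<in>\<Lambda>. \<zeta> i = \<eta> i}" for \<zeta>
  proof -
    have "f \<eta> = f \<zeta>" by (rule depends_onD[OF assms(2)]) (use that in auto)
    then show ?thesis using B by simp
  qed
  then show "\<exists>A. open A \<and> \<eta> \<in> A \<and> (\<forall>\<zeta>\<in>UNIV. \<zeta> \<in> A \<longrightarrow> f \<zeta> \<in> B)"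
    using open_agree[OF assms(1), of \<eta>] by blast
qed

lemma depends_on_decompose:
  assumes "finite \<Lambda>" "depends_on \<Lambda> f"
  shows "f \<eta> = (\<Sum>x\<in>Pow \<Lambda>. f (config_of x) * indicator (cylinder \<Lambda> x) \<eta>)"
proof -
  have "(\<Sum>x\<in>Pow \<Lambda>. f (config_of x) * indicator (cylinder \<Lambda> x) \<eta>)
      = (\<Sum>x\<in>Pow \<Lambda>. if x = {i\<in>\<Lambda>. \<eta> i} then f (config_of x) else 0)"
    by (intro sum.cong) (auto simp: cylinder_def indicator_def)
  also have "\<dots> = f (config_of {i\<in>\<Lambda>. \<eta> i})"
    using assms(1) by (subst sum.delta) auto
  also have "\<dots> = f \<eta>" by (rule depends_onD[OF assms(2)]) simp
  finally show ?thesis by simp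
qed

lemma depends_on_bcontfun:
  assumes "finite \<Lambda>" "depends_on \<Lambda> f" shows "f \<in> bcontfun"
proof (rule bcontfun_normI[OF depends_on_continuous[OF assms]])
  fix \<eta>
  have "f \<eta> = f (config_of {i\<in>\<Lambda>. \<eta> i})" by (rule depends_onD[OF assms(2)]) simp
  also have "norm \<dots> \<le> (\<Sum>x\<in>Pow \<Lambda>. norm (f (config_of x)))"
    using assms(1) by (intro member_le_sum) auto
  finally show "norm (f \<eta>) \<le> (\<Sum>x\<in>Pow \<Lambda>. norm (f (config_of x)))" .
qed

definition box :: "nat \<Rightarrow> int set" where
  "box m = {- int m..int m}"

lemma finite_box [simp]: "finite (box m)" by (simp add: box_def)

lemma finite_subset_box:
  assumes "finite A" obtains m where "A \<subseteq> box m"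
proof -
  have "bdd_above ((\<lambda>j. nat \<bar>j\<bar>) ` A)" using assms by simp
  then obtain n where "\<And>j. j \<in> A \<Longrightarrow> nat \<bar>j\<bar> \<le> n"
    unfolding bdd_above_def by blast
  then have "A \<subseteq> box n" by (force simp: box_def)
  then show ?thesis by (rule that)
qed

lemma finitely_dependentE:
  assumes "finitely_dependent f"
  obtains m where "depends_on (box m) f"
proof -
  obtain A where A: "finite A" "depends_on A f"
    using assms unfolding finitely_dependent_iff by (elim exE conjE)
  obtain m where "A \<subseteq> box m" using finite_subset_box[OF A(1)] .
  then show ?thesis by (intro that depends_on_mono[OF A(2)])
qed

lemma depends_on_box_imp_finitely_dependent: "depends_on (box m) f \<Longrightarrow> finitely_dependent f"
  unfolding finitely_dependent_iff by (intro exI[of _ "box m"] conjI finite_box)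

lemma generator_depends_on:
  assumes "depends_on (box m) f"
  shows "depends_on (box (Suc m)) (exclusion_generator p q f)"
  unfolding exclusion_generator_eq_sum[OF finite_box assms, abs_def]
proof (intro depends_on_sum depends_on_mult depends_on_diff)
  fix i assume "i \<in> bonds (box m)"
  then have i: "{i, i + 1} \<subseteq> box (Suc m)" by (auto simp: bonds_def box_def)
  show "depends_on (box (Suc m)) (bond_rate p q i)" using i by (rule depends_on_bond_rate)
  show f: "depends_on (box (Suc m)) f" by (rule depends_on_mono[OF assms]) (auto simp: box_def)
  show "depends_on (box (Suc m)) (\<lambda>\<eta>. f (swap_sites \<eta> i))" using f i by (rule depends_on_swap_sites)
qed

text \<open>
  Only the \<open>2 * m + 2\<close> bonds that touch the box contribute, each at most \<open>2 * c\<close>.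
\<close>

lemma generator_bound:
  assumes "depends_on (box m) f" and f: "\<And>\<eta>. \<bar>f \<eta>\<bar> \<le> c"
    and rates: "\<And>i. 0 \<le> p i \<and> p i \<le> 1" "\<And>i. 0 \<le> q i \<and> q i \<le> 1"
  shows "\<bar>exclusion_generator p q f \<eta>\<bar> \<le> 4 * real (Suc m) * c"
proof -
  have "\<bar>exclusion_generator p q f \<eta>\<bar> \<le> (\<Sum>i\<in>bonds (box m). \<bar>bond_rate p q i \<eta> * (f (swap_sites \<eta> i) - f \<eta>)\<bar>)"
    unfolding exclusion_generator_eq_sum[OF finite_box assms(1)] by (rule sum_abs)
  also have "\<dots> \<le> (\<Sum>i\<in>bonds (box m). 2 * c)"
  proof (rule sum_mono)
    fix i
    have "\<bar>bond_rate p q i \<eta>\<bar> \<le> 1"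
      using bond_rate_bounds[of p q, OF rates] by (simp add: abs_le_iff)
    moreover have "\<bar>f (swap_sites \<eta> i) - f \<eta>\<bar> \<le> 2 * c"
      using f[of "swap_sites \<eta> i"] f[of \<eta>] by linarith
    ultimately have "\<bar>bond_rate p q i \<eta>\<bar> * \<bar>f (swap_sites \<eta> i) - f \<eta>\<bar> \<le> 1 * (2 * c)"
      by (intro mult_mono) auto
    then show "\<bar>bond_rate p q i \<eta> * (f (swap_sites \<eta> i) - f \<eta>)\<bar> \<le> 2 * c"
      by (simp add: abs_mult)
  qed
  also have "\<dots> = real (card (bonds (box m))) * (2 * c)" by simp
  also have "bonds (box m) = {- int m - 1..int m}" by (auto simp: bonds_def box_def)
  also have "real (card {- int m - 1..int m}) * (2 * c) = 4 * real (Suc m) * c"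
    by (simp add: algebra_simps)
  finally show ?thesis .
qed

text \<open>
  Applied to \<open>d i = ln (p i) - ln (q (i + 1))\<close>, this gives the logarithm of the weights \<open>\<pi>\<close>
  with \<open>\<pi> i * p i = \<pi> (i + 1) * q (i + 1)\<close>.
\<close>

lemma ex_int_potential:
  fixes d :: "int \<Rightarrow> real"
  obtains u where "\<And>i. u (i + 1) - u i = d i"
proof
  define u where "u i = (if 0 \<le> i then \<Sum>j\<in>{0..<i}. d j else - (\<Sum>j\<in>{i..<0}. d j))" for i
  fix i :: int
  show "u (i + 1) - u i = d i"
  proof (cases "0 \<le> i")
    case True
    then have "{0..<i + 1} = insert i {0..<i}" by auto
    then show ?thesis using True by (simp add: u_def)
  next
    case False
    then have *: "{i..<0} = insert i {i + 1..<0}" by auto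
    have "i + 1 = 0 \<or> i + 1 < 0" using False by linarith
    then show ?thesis using False by (auto simp: u_def *)
  qed
qed

section \<open>Stationary measures: cylinder masses and flows across a bond\<close>

text \<open>
  A measure that is infinitesimally invariant.  Only the action of the generator on functions
  of finitely many sites enters until the semigroup appears.
\<close>

locale generator_stationary = prob_space \<mu> for \<mu> :: "config measure" +
  fixes p q :: "int \<Rightarrow> real"
  assumes sets_eq: "sets \<mu> = sets borel"
    and p_pos: "\<And>i. 0 < p i" and p_le: "\<And>i. p i \<le> 1"
    and q_pos: "\<And>i. 0 < q i" and q_le: "\<And>i. q i \<le> 1"
    and stationary: "\<And>f. finitely_dependent f \<Longrightarrow> (\<integral>\<eta>. exclusion_generator p q f \<eta> \<partial>\<mu>) = 0"
begin

definition mass :: "int set \<Rightarrow> int set \<Rightarrow> real" where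
  "mass \<Lambda> x = prob (cylinder \<Lambda> x)"

lemma space_eq: "space \<mu> = UNIV"
  using sets_eq_imp_space_eq[OF sets_eq] by simp

lemma cylinder_sets [measurable]: "finite \<Lambda> \<Longrightarrow> cylinder \<Lambda> x \<in> events"
  using open_cylinder[of \<Lambda> x] sets_eq by simp

lemma mass_nonneg [simp]: "0 \<le> mass \<Lambda> x"
  by (simp add: mass_def)

lemma integrable_depends_on:
  assumes "finite \<Lambda>" "depends_on \<Lambda> f" shows "integrable \<mu> f"
  by (subst depends_on_decompose[OF assms, abs_def])
    (intro Bochner_Integration.integrable_sum integrable_mult_right integrable_real_indicator
      cylinder_sets assms(1), simp add: emeasure_eq_measure)

lemma integral_depends_on:
  assumes "finite \<Lambda>" "depends_on \<Lambda> f"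
  shows "(\<integral>\<eta>. f \<eta> \<partial>\<mu>) = (\<Sum>x\<in>Pow \<Lambda>. f (config_of x) * mass \<Lambda> x)"
proof -
  have int: "integrable \<mu> (\<lambda>\<eta>. f (config_of x) * indicator (cylinder \<Lambda> x) \<eta>)" for x
    using assms(1) by (intro integrable_mult_right integrable_real_indicator cylinder_sets)
      (simp_all add: emeasure_eq_measure)
  have "(\<integral>\<eta>. f \<eta> \<partial>\<mu>) = (\<integral>\<eta>. (\<Sum>x\<in>Pow \<Lambda>. f (config_of x) * indicator (cylinder \<Lambda> x) \<eta>) \<partial>\<mu>)"
    by (subst depends_on_decompose[OF assms, abs_def]) simp
  also have "\<dots> = (\<Sum>x\<in>Pow \<Lambda>. (\<integral>\<eta>. f (config_of x) * indicator (cylinder \<Lambda> x) \<eta> \<partial>\<mu>))"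
    by (rule Bochner_Integration.integral_sum[OF int])
  also have "\<dots> = (\<Sum>x\<in>Pow \<Lambda>. f (config_of x) * mass \<Lambda> x)"
    using assms(1) by (simp add: mass_def space_eq)
  finally show ?thesis .
qed

lemma sum_mass: "finite \<Lambda> \<Longrightarrow> (\<Sum>x\<in>Pow \<Lambda>. mass \<Lambda> x) = 1"
  using integral_depends_on[of \<Lambda> "\<lambda>_. 1"] by (simp add: depends_on_def prob_space)

lemma mass_mono:
  assumes "finite \<Lambda>'" "\<Lambda> \<subseteq> \<Lambda>'" shows "mass \<Lambda>' x \<le> mass \<Lambda> (\<Lambda> \<inter> x)"
  unfolding mass_def using assms finite_subset[OF assms(2,1)]
  by (intro finite_measure_mono cylinder_sets) (auto simp: cylinder_def)

lemma mass_split: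
  assumes "finite \<Lambda>" "k \<notin> \<Lambda>" "x \<subseteq> \<Lambda>"
  shows "mass \<Lambda> x = mass (insert k \<Lambda>) x + mass (insert k \<Lambda>) (insert k x)"
proof -
  have k: "k \<notin> x" using assms by auto
  have "cylinder \<Lambda> x = cylinder (insert k \<Lambda>) x \<union> cylinder (insert k \<Lambda>) (insert k x)"
    using assms(2) k by (auto simp: cylinder_def)
  moreover have "cylinder (insert k \<Lambda>) x \<inter> cylinder (insert k \<Lambda>) (insert k x) = {}"
    using k by (auto simp: cylinder_def)
  ultimately show ?thesis
    unfolding mass_def using assms(1) by (simp add: finite_measure_Union cylinder_sets)
qed

text \<open>
  The flow from left to right across the bond \<open>{i, i + 1}\<close>, restricted to the configurations that
  agree with \<open>x\<close> on \<open>\<Lambda> - {i, i + 1}\<close>.  The set \<open>\<Lambda>\<close> need not contain the bond: for a bond that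
  straddles the boundary of \<open>\<Lambda>\<close> the outer site is added.
\<close>

definition flow_right :: "int set \<Rightarrow> int \<Rightarrow> int set \<Rightarrow> real" where
  "flow_right \<Lambda> i x = p i * mass (\<Lambda> \<union> {i, i + 1}) (insert i x)"

definition flow_left :: "int set \<Rightarrow> int \<Rightarrow> int set \<Rightarrow> real" where
  "flow_left \<Lambda> i x = q (i + 1) * mass (\<Lambda> \<union> {i, i + 1}) (insert (i + 1) x)"

lemma flow_nonneg [simp]: "0 \<le> flow_right \<Lambda> i x" "0 \<le> flow_left \<Lambda> i x"
  using p_pos[of i] q_pos[of "i + 1"] by (simp_all add: flow_right_def flow_left_def)

lemma flow_le_mass:
  assumes "finite \<Lambda>"
  shows "flow_right \<Lambda> i x \<le> mass \<Lambda> (\<Lambda> \<inter> insert i x)"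
    and "flow_left \<Lambda> i x \<le> mass \<Lambda> (\<Lambda> \<inter> insert (i + 1) x)"
proof -
  have "flow_right \<Lambda> i x \<le> 1 * mass (\<Lambda> \<union> {i, i + 1}) (insert i x)"
    unfolding flow_right_def by (intro mult_right_mono p_le) simp
  also have "\<dots> \<le> mass \<Lambda> (\<Lambda> \<inter> insert i x)"
    using assms unfolding mult_1 by (intro mass_mono) auto
  finally show "flow_right \<Lambda> i x \<le> mass \<Lambda> (\<Lambda> \<inter> insert i x)" .
  have "flow_left \<Lambda> i x \<le> 1 * mass (\<Lambda> \<union> {i, i + 1}) (insert (i + 1) x)"
    unfolding flow_left_def by (intro mult_right_mono q_le) simp
  also have "\<dots> \<le> mass \<Lambda> (\<Lambda> \<inter> insert (i + 1) x)"
    using assms unfolding mult_1 by (intro mass_mono) auto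
  finally show "flow_left \<Lambda> i x \<le> mass \<Lambda> (\<Lambda> \<inter> insert (i + 1) x)" .
qed

lemma flow_split:
  assumes "finite \<Lambda>" "k \<notin> \<Lambda> \<union> {i, i + 1}" "x \<subseteq> \<Lambda> - {i, i + 1}"
  shows "flow_right \<Lambda> i x = flow_right (insert k \<Lambda>) i x + flow_right (insert k \<Lambda>) i (insert k x)"
    and "flow_left \<Lambda> i x = flow_left (insert k \<Lambda>) i x + flow_left (insert k \<Lambda>) i (insert k x)"
proof -
  have "mass (\<Lambda> \<union> {i, i + 1}) (insert j x) = mass (insert k (\<Lambda> \<union> {i, i + 1})) (insert j x)
      + mass (insert k (\<Lambda> \<union> {i, i + 1})) (insert k (insert j x))" if "j \<in> {i, i + 1}" for j
    using assms that by (intro mass_split) auto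
  then show "flow_right \<Lambda> i x = flow_right (insert k \<Lambda>) i x + flow_right (insert k \<Lambda>) i (insert k x)"
    and "flow_left \<Lambda> i x = flow_left (insert k \<Lambda>) i x + flow_left (insert k \<Lambda>) i (insert k x)"
    by (simp_all add: flow_right_def flow_left_def insert_commute distrib_left)
qed

lemma integral_bond_rate:
  assumes "finite \<Lambda>" "depends_on (\<Lambda> \<union> {i, i + 1}) H"
  shows "(\<integral>\<eta>. bond_rate p q i \<eta> * H \<eta> \<partial>\<mu>)
    = (\<Sum>x\<in>Pow (\<Lambda> - {i, i + 1}). flow_right \<Lambda> i x * H (config_of (insert i x))
                                  + flow_left \<Lambda> i x * H (config_of (insert (i + 1) x)))"
proof -
  let ?L = "\<Lambda> \<union> {i, i + 1}"
  let ?h = "\<lambda>x. bond_rate p q i (config_of x) * H (config_of x) * mass ?L x"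
  have "(\<integral>\<eta>. bond_rate p q i \<eta> * H \<eta> \<partial>\<mu>) = (\<Sum>x\<in>Pow ?L. ?h x)"
    using assms by (intro integral_depends_on depends_on_mult depends_on_bond_rate) auto
  also have "\<dots> = (\<Sum>x\<in>Pow (?L - {i, i + 1}). ?h (insert i x) + ?h (insert (i + 1) x))"
    using assms(1) by (intro sum_Pow_bond) (auto simp: bond_rate_def)
  also have "?L - {i, i + 1} = \<Lambda> - {i, i + 1}" by auto
  also have "(\<Sum>x\<in>Pow (\<Lambda> - {i, i + 1}). ?h (insert i x) + ?h (insert (i + 1) x))
    = (\<Sum>x\<in>Pow (\<Lambda> - {i, i + 1}). flow_right \<Lambda> i x * H (config_of (insert i x))
                                  + flow_left \<Lambda> i x * H (config_of (insert (i + 1) x)))"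
    by (intro sum.cong refl) (auto simp: bond_rate_def flow_right_def flow_left_def)
  finally show ?thesis .
qed

lemma integrable_bond_rate:
  assumes "finite \<Lambda>" "depends_on (\<Lambda> \<union> {i, i + 1}) H"
  shows "integrable \<mu> (\<lambda>\<eta>. bond_rate p q i \<eta> * H \<eta>)"
  using assms by (intro integrable_depends_on[of "\<Lambda> \<union> {i, i + 1}"]
      depends_on_mult depends_on_bond_rate) auto

lemma depends_on_swap:
  assumes "depends_on \<Lambda> f"
  shows "depends_on (\<Lambda> \<union> {i, i + 1}) f" "depends_on (\<Lambda> \<union> {i, i + 1}) (\<lambda>\<eta>. f (swap_sites \<eta> i))"
proof -
  show 1: "depends_on (\<Lambda> \<union> {i, i + 1}) f" by (rule depends_on_mono[OF assms]) auto
  show "depends_on (\<Lambda> \<union> {i, i + 1}) (\<lambda>\<eta>. f (swap_sites \<eta> i))"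
    by (rule depends_on_swap_sites[OF 1]) auto
qed

lemma sum_integral_bonds_eq_0:
  assumes "finite \<Lambda>" "depends_on \<Lambda> f"
  shows "(\<Sum>i\<in>bonds \<Lambda>. \<integral>\<eta>. bond_rate p q i \<eta> * (f (swap_sites \<eta> i) - f \<eta>) \<partial>\<mu>) = 0"
proof -
  have dep: "depends_on (\<Lambda> \<union> {i, i + 1}) (\<lambda>\<eta>. f (swap_sites \<eta> i) - f \<eta>)" for i
    by (intro depends_on_diff depends_on_swap assms(2))
  have "0 = (\<integral>\<eta>. exclusion_generator p q f \<eta> \<partial>\<mu>)"
    using assms by (intro stationary[symmetric]) (auto simp: finitely_dependent_iff)
  also have "\<dots> = (\<Sum>i\<in>bonds \<Lambda>. \<integral>\<eta>. bond_rate p q i \<eta> * (f (swap_sites \<eta> i) - f \<eta>) \<partial>\<mu>)"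
    unfolding exclusion_generator_eq_sum[OF assms, abs_def]
    by (intro Bochner_Integration.integral_sum integrable_bond_rate[OF assms(1) dep])
  finally show ?thesis by simp
qed

lemma flow_balance:
  assumes "finite \<Lambda>" "depends_on \<Lambda> f"
  shows "(\<Sum>i\<in>bonds \<Lambda>. \<Sum>x\<in>Pow (\<Lambda> - {i, i + 1}). (flow_right \<Lambda> i x - flow_left \<Lambda> i x)
            * (f (config_of (insert (i + 1) x)) - f (config_of (insert i x)))) = 0"
proof -
  have "(\<integral>\<eta>. bond_rate p q i \<eta> * (f (swap_sites \<eta> i) - f \<eta>) \<partial>\<mu>)
      = (\<Sum>x\<in>Pow (\<Lambda> - {i, i + 1}). (flow_right \<Lambda> i x - flow_left \<Lambda> i x)
            * (f (config_of (insert (i + 1) x)) - f (config_of (insert i x))))" for i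
  proof -
    have dep: "depends_on (\<Lambda> \<union> {i, i + 1}) (\<lambda>\<eta>. f (swap_sites \<eta> i) - f \<eta>)"
      by (intro depends_on_diff depends_on_swap assms(2))
    have *: "swap_sites (config_of (insert i x)) i = config_of (insert (i + 1) x)"
       "swap_sites (config_of (insert (i + 1) x)) i = config_of (insert i x)"
      if "x \<in> Pow (\<Lambda> - {i, i + 1})" for x
      by (rule swap_config_of; use that in auto)+
    show ?thesis
      unfolding integral_bond_rate[OF assms(1) dep]
      by (intro sum.cong refl, simp only: *) (simp add: algebra_simps)
  qed
  then show ?thesis using sum_integral_bonds_eq_0[OF assms] by simp
qed

text \<open>
  Stationarity of the indicator of a null cylinder: the outflow is at most its mass, hence zero, so
  the inflow is zero as well, and the inflow is a sum of nonnegative terms.  This is what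
  makes the value of \<open>ln 0\<close> harmless in the entropy argument.
\<close>

lemma mass_0_imp_inflow_0:
  assumes fin: "finite \<Lambda>" and x: "x \<subseteq> \<Lambda> - {i, i + 1}" and i: "i \<in> bonds \<Lambda>"
  shows "mass \<Lambda> (\<Lambda> \<inter> insert i x) = 0 \<Longrightarrow> flow_left \<Lambda> i x = 0"
    and "mass \<Lambda> (\<Lambda> \<inter> insert (i + 1) x) = 0 \<Longrightarrow> flow_right \<Lambda> i x = 0"
proof -
  have inflow: "(\<integral>\<eta>. bond_rate p q i \<eta> * indicator (cylinder \<Lambda> y) (swap_sites \<eta> i) \<partial>\<mu>) = 0"
    if y: "mass \<Lambda> y = 0" for y
  proof -
    define f :: "config \<Rightarrow> real" where "f = indicator (cylinder \<Lambda> y)"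
    have f0: "0 \<le> f \<eta>" for \<eta> by (simp add: f_def)
    have dep: "depends_on \<Lambda> f"
      by (auto simp: f_def depends_on_def indicator_def cylinder_def)
    have int: "integrable \<mu> (\<lambda>\<eta>. bond_rate p q j \<eta> * f (swap_sites \<eta> j))"
      "integrable \<mu> (\<lambda>\<eta>. bond_rate p q j \<eta> * f \<eta>)" for j
      by (intro integrable_bond_rate[OF fin] depends_on_swap dep)+
    have rate: "0 \<le> bond_rate p q j \<eta>" "bond_rate p q j \<eta> \<le> 1" for j \<eta>
      using bond_rate_bounds[of p q] p_pos p_le q_pos q_le by (auto simp: less_imp_le)
    have f: "(\<integral>\<eta>. f \<eta> \<partial>\<mu>) = 0"
      using y by (simp add: f_def space_eq mass_def)
    have out: "(\<integral>\<eta>. bond_rate p q j \<eta> * f \<eta> \<partial>\<mu>) = 0" for j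
    proof (rule antisym)
      have "(\<integral>\<eta>. bond_rate p q j \<eta> * f \<eta> \<partial>\<mu>) \<le> (\<integral>\<eta>. 1 * f \<eta> \<partial>\<mu>)"
        by (intro integral_mono int mult_right_mono rate f0)
          (use integrable_depends_on[OF fin dep] in simp)
      then show "(\<integral>\<eta>. bond_rate p q j \<eta> * f \<eta> \<partial>\<mu>) \<le> 0" using f by simp
      show "0 \<le> (\<integral>\<eta>. bond_rate p q j \<eta> * f \<eta> \<partial>\<mu>)"
        by (intro Bochner_Integration.integral_nonneg mult_nonneg_nonneg rate f0)
    qed
    have "(\<Sum>j\<in>bonds \<Lambda>. \<integral>\<eta>. bond_rate p q j \<eta> * f (swap_sites \<eta> j) \<partial>\<mu>) = 0"
      using sum_integral_bonds_eq_0[OF fin dep] int out by (simp add: right_diff_distrib)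
    then have "\<forall>j\<in>bonds \<Lambda>. (\<integral>\<eta>. bond_rate p q j \<eta> * f (swap_sites \<eta> j) \<partial>\<mu>) = 0"
      using fin rate f0 by (subst (asm) sum_nonneg_eq_0_iff) (auto intro!: Bochner_Integration.integral_nonneg)
    then show ?thesis using i by (simp add: f_def)
  qed
  have le: "flow_right \<Lambda> i x * indicator (cylinder \<Lambda> y) (config_of (insert (i + 1) x))
      + flow_left \<Lambda> i x * indicator (cylinder \<Lambda> y) (config_of (insert i x)) \<le>
        (\<integral>\<eta>. bond_rate p q i \<eta> * indicator (cylinder \<Lambda> y) (swap_sites \<eta> i) \<partial>\<mu>)" for y
  proof -
    define f :: "config \<Rightarrow> real" where "f = indicator (cylinder \<Lambda> y)"
    have f0: "0 \<le> f \<eta>" for \<eta> by (simp add: f_def)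
    have dep: "depends_on \<Lambda> f"
      by (auto simp: f_def depends_on_def indicator_def cylinder_def)
    have *: "swap_sites (config_of (insert i x)) i = config_of (insert (i + 1) x)"
       "swap_sites (config_of (insert (i + 1) x)) i = config_of (insert i x)"
      by (rule swap_config_of; use x in auto)+
    have "flow_right \<Lambda> i x * f (swap_sites (config_of (insert i x)) i)
      + flow_left \<Lambda> i x * f (swap_sites (config_of (insert (i + 1) x)) i)
      \<le> (\<Sum>x\<in>Pow (\<Lambda> - {i, i + 1}). flow_right \<Lambda> i x * f (swap_sites (config_of (insert i x)) i)
             + flow_left \<Lambda> i x * f (swap_sites (config_of (insert (i + 1) x)) i))"
      using fin x f0
      by (intro member_le_sum[of x _ "\<lambda>x. flow_right \<Lambda> i x * f (swap_sites (config_of (insert i x)) i)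
             + flow_left \<Lambda> i x * f (swap_sites (config_of (insert (i + 1) x)) i)"]) auto
    also have "\<dots> = (\<integral>\<eta>. bond_rate p q i \<eta> * f (swap_sites \<eta> i) \<partial>\<mu>)"
      by (rule integral_bond_rate[symmetric, OF fin depends_on_swap(2)[OF dep]])
    finally show ?thesis unfolding * f_def .
  qed
  have in_cyl: "config_of z \<in> cylinder \<Lambda> (\<Lambda> \<inter> z)" for z by (auto simp: cylinder_def)
  show "flow_left \<Lambda> i x = 0" if "mass \<Lambda> (\<Lambda> \<inter> insert i x) = 0"
  proof (rule antisym[OF _ flow_nonneg(2)])
    have "0 \<le> flow_right \<Lambda> i x * indicator (cylinder \<Lambda> (\<Lambda> \<inter> insert i x)) (config_of (insert (i + 1) x))"
      by simp
    then show "flow_left \<Lambda> i x \<le> 0"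
      using le[of "\<Lambda> \<inter> insert i x"]
      unfolding inflow[OF that] indicator_simps(1)[OF in_cyl] by linarith
  qed
  show "flow_right \<Lambda> i x = 0" if "mass \<Lambda> (\<Lambda> \<inter> insert (i + 1) x) = 0"
  proof (rule antisym[OF _ flow_nonneg(1)])
    have "0 \<le> flow_left \<Lambda> i x * indicator (cylinder \<Lambda> (\<Lambda> \<inter> insert (i + 1) x)) (config_of (insert i x))"
      by simp
    then show "flow_right \<Lambda> i x \<le> 0"
      using le[of "\<Lambda> \<inter> insert (i + 1) x"]
      unfolding inflow[OF that] indicator_simps(1)[OF in_cyl] by linarith
  qed
qed

text \<open>
  Once \<open>\<Lambda>\<close> is enlarged by the bond, the flows are positive multiples of cylinder masses, and
  \<open>mass_0_imp_inflow_0\<close> shows that the vanishing of either mass stops the flow out of the other.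
\<close>

lemma flow_right_eq_0_iff:
  assumes "finite \<Lambda>" "x \<subseteq> \<Lambda> - {i, i + 1}"
  shows "flow_right \<Lambda> i x = 0 \<longleftrightarrow> flow_left \<Lambda> i x = 0"
proof -
  define \<Lambda>' where "\<Lambda>' = \<Lambda> \<union> {i, i + 1}"
  have eq: "flow_right \<Lambda> i x = p i * mass \<Lambda>' (\<Lambda>' \<inter> insert i x)"
    "flow_left \<Lambda> i x = q (i + 1) * mass \<Lambda>' (\<Lambda>' \<inter> insert (i + 1) x)"
    "flow_right \<Lambda>' i x = flow_right \<Lambda> i x" "flow_left \<Lambda>' i x = flow_left \<Lambda> i x"
    using assms(2) by (auto simp: flow_right_def flow_left_def \<Lambda>'_def Int_absorb1 subset_iff
        intro!: arg_cong2[where f = mass])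
  have "finite \<Lambda>'" "x \<subseteq> \<Lambda>' - {i, i + 1}" "i \<in> bonds \<Lambda>'"
    using assms by (auto simp: \<Lambda>'_def bonds_def)
  from mass_0_imp_inflow_0[OF this] show ?thesis
    using p_pos[of i] q_pos[of "i + 1"] unfolding eq(3,4) by (auto simp: eq(1,2))
qed

section \<open>The current\<close>

definition current :: "int \<Rightarrow> real" where
  "current i = (\<integral>\<eta>. bond_rate p q i \<eta> * (of_bool (\<eta> i) - of_bool (\<eta> (i + 1))) \<partial>\<mu>)"

lemma sum_flow_diff:
  assumes "finite \<Lambda>"
  shows "(\<Sum>x\<in>Pow (\<Lambda> - {i, i + 1}). flow_right \<Lambda> i x - flow_left \<Lambda> i x) = current i"
proof -
  have "depends_on (\<Lambda> \<union> {i, i + 1}) (\<lambda>\<eta>. of_bool (\<eta> i) - of_bool (\<eta> (i + 1)))"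
    by (auto simp: depends_on_def)
  from integral_bond_rate[OF assms this] show ?thesis
    unfolding current_def by (auto intro!: sum.cong)
qed

text \<open>
  Stationarity of \<open>\<eta> i\<close>: what enters site \<open>i\<close> from the left leaves it to the right.
\<close>

lemma current_step: "current (i - 1) = current i"
proof -
  have dep: "depends_on {i} (\<lambda>\<eta>. of_bool (\<eta> i))" by (simp add: depends_on_def)
  have bonds: "bonds {i} = {i - 1, i}" by (auto simp: bonds_def)
  have swap: "swap_sites \<eta> i i = \<eta> (i + 1)" "swap_sites \<eta> (i - 1) i = \<eta> (i - 1)" for \<eta>
    by (simp_all add: swap_sites_apply)
  have "current (i - 1) = (\<integral>\<eta>. bond_rate p q (i - 1) \<eta> * (of_bool (\<eta> (i - 1)) - of_bool (\<eta> i)) \<partial>\<mu>)"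
    by (simp add: current_def)
  also have "\<dots> = - (\<integral>\<eta>. bond_rate p q i \<eta> * (of_bool (\<eta> (i + 1)) - of_bool (\<eta> i)) \<partial>\<mu>)"
    using sum_integral_bonds_eq_0[OF _ dep] unfolding bonds by (simp add: swap)
  also have "\<dots> = (\<integral>\<eta>. - (bond_rate p q i \<eta> * (of_bool (\<eta> (i + 1)) - of_bool (\<eta> i))) \<partial>\<mu>)"
    by (rule Bochner_Integration.integral_minus[symmetric])
  also have "\<dots> = current i"
    unfolding current_def by (intro Bochner_Integration.integral_cong refl) (simp add: algebra_simps)
  finally show ?thesis .
qed

lemma current_const: "current i = current j"
proof -
  have "current i = current 0" for i
  proof (induction i rule: int_induct[where k = 0])
    case (step1 i) then show ?case using current_step[of "i + 1"] by simp
  next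
    case (step2 i) then show ?case using current_step[of i] by simp
  qed simp
  then show ?thesis by metis
qed

lemma integrable_site: "integrable \<mu> (\<lambda>\<eta>. of_bool (\<eta> i) :: real)"
  by (rule integrable_depends_on[of "{i}"]) (auto simp: depends_on_def)

lemma integrable_current:
  "integrable \<mu> (\<lambda>\<eta>. bond_rate p q i \<eta> * (of_bool (\<eta> i) - of_bool (\<eta> (i + 1))))"
  by (rule integrable_bond_rate[of "{}"]) (auto simp: depends_on_def)

definition site_density :: "int \<Rightarrow> real" where
  "site_density i = (\<integral>\<eta>. of_bool (\<eta> i) \<partial>\<mu>)"

text \<open>
  At \<open>p i = q (i + 1) = 1/2\<close> the net flow across the bond is exactly the discrete gradient
  \<open>(\<eta> i - \<eta> (i + 1)) / 2\<close>.
\<close>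

lemma current_le:
  assumes "p i \<le> 1/2 + \<epsilon>" "1/2 - \<epsilon> \<le> q (i + 1)" "0 \<le> \<epsilon>"
  shows "current i \<le> (site_density i - site_density (i + 1)) / 2 + \<epsilon>"
proof -
  have "current i \<le> (\<integral>\<eta>. (of_bool (\<eta> i) - of_bool (\<eta> (i + 1))) / 2 + \<epsilon> \<partial>\<mu>)"
    unfolding current_def using assms
    by (intro integral_mono integrable_current) (auto simp: bond_rate_def integrable_site)
  also have "\<dots> = (site_density i - site_density (i + 1)) / 2 + \<epsilon>"
    by (simp add: site_density_def integrable_site prob_space)
  finally show ?thesis .
qed

lemma current_ge:
  assumes "1/2 - \<epsilon> \<le> p i" "q (i + 1) \<le> 1/2 + \<epsilon>" "0 \<le> \<epsilon>"
  shows "(site_density i - site_density (i + 1)) / 2 - \<epsilon> \<le> current i"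
proof -
  have "(site_density i - site_density (i + 1)) / 2 - \<epsilon>
      = (\<integral>\<eta>. (of_bool (\<eta> i) - of_bool (\<eta> (i + 1))) / 2 - \<epsilon> \<partial>\<mu>)"
    by (simp add: site_density_def integrable_site prob_space)
  also have "\<dots> \<le> current i"
    unfolding current_def using assms
    by (intro integral_mono integrable_current) (auto simp: bond_rate_def integrable_site)
  finally show ?thesis .
qed

lemma site_density_bounds: "0 \<le> site_density i" "site_density i \<le> (1::real)"
  using integral_mono[OF integrable_site, of "\<lambda>_. 1" i]
  by (auto intro!: Bochner_Integration.integral_nonneg simp: site_density_def prob_space)

lemma site_density_diff_bounds:
  "(site_density i - site_density j) / 2 \<le> 1 / 2" "- (1 / 2) \<le> (site_density i - site_density j) / 2"
proof -
  show "(site_density i - site_density j) / 2 \<le> 1 / 2"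
    using diff_mono[OF site_density_bounds(2)[of i] site_density_bounds(1)[of j]] by simp
  show "- (1 / 2) \<le> (site_density i - site_density j) / 2"
    using diff_mono[OF site_density_bounds(1)[of i] site_density_bounds(2)[of j]] by simp
qed

lemma sum_density_diff:
  "(\<Sum>j<n. site_density (k + int j) - site_density (k + int j + 1))
     = site_density k - site_density (k + int n)"
  by (induction n) (simp_all add: algebra_simps)

text \<open>
  The current is the same at all bonds, so it equals its average over the stretch, where the
  gradient terms telescope.
\<close>

lemma current_le_of_stretch:
  assumes "\<And>i. k \<le> i \<Longrightarrow> i \<le> k + int n \<Longrightarrow> p i \<le> 1/2 + \<epsilon> \<and> 1/2 - \<epsilon> \<le> q i"
    and "0 < n" "0 \<le> \<epsilon>"
  shows "current i \<le> 1 / (2 * real n) + \<epsilon>"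
proof -
  have const: "current (k + int j) = current i" for j by (rule current_const)
  have "real n * current i = (\<Sum>j<n. current (k + int j))"
    by (simp add: const)
  also have "\<dots> \<le> (\<Sum>j<n. (site_density (k + int j)
                            - site_density (k + int j + 1)) / 2 + \<epsilon>)"
    using assms(1,3) by (intro sum_mono current_le) auto
  also have "\<dots> = (site_density k - site_density (k + int n)) / 2 + real n * \<epsilon>"
    by (simp add: sum.distrib sum_density_diff flip: sum_divide_distrib)
  also have "\<dots> \<le> 1 / 2 + real n * \<epsilon>"
    using site_density_diff_bounds[of k "k + int n"] by simp
  finally show ?thesis using assms(2) by (simp add: field_simps)
qed

lemma current_ge_of_stretch:
  assumes "\<And>i. k \<le> i \<Longrightarrow> i \<le> k + int n \<Longrightarrow> 1/2 - \<epsilon> \<le> p i \<and> q i \<le> 1/2 + \<epsilon>"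
    and "0 < n" "0 \<le> \<epsilon>"
  shows "- (1 / (2 * real n) + \<epsilon>) \<le> current i"
proof -
  have const: "current (k + int j) = current i" for j by (rule current_const)
  have "- (1 / 2 + real n * \<epsilon>)
      \<le> (site_density k - site_density (k + int n)) / 2 - real n * \<epsilon>"
    using site_density_diff_bounds[of k "k + int n"] by simp
  also have "\<dots> = (\<Sum>j<n. (site_density (k + int j)
                            - site_density (k + int j + 1)) / 2 - \<epsilon>)"
    unfolding sum_density_diff[symmetric]
    by (simp add: sum_subtractf sum_divide_distrib diff_divide_distrib)
  also have "\<dots> \<le> (\<Sum>j<n. current (k + int j))"
    using assms(1,3) by (intro sum_mono current_ge) auto
  also have "\<dots> = real n * current i"
    by (simp add: const)
  finally show ?thesis using assms(2) by (simp add: field_simps)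
qed

section \<open>Entropy balance\<close>

definition dissipation :: "int set \<Rightarrow> int \<Rightarrow> real" where
  "dissipation \<Lambda> i = (\<Sum>x\<in>Pow (\<Lambda> - {i, i + 1}). bond_dissipation (flow_right \<Lambda> i x) (flow_left \<Lambda> i x))"

lemma bond_dissipation_flow_nonneg:
  "finite \<Lambda> \<Longrightarrow> x \<subseteq> \<Lambda> - {i, i + 1} \<Longrightarrow> 0 \<le> bond_dissipation (flow_right \<Lambda> i x) (flow_left \<Lambda> i x)"
  by (intro bond_dissipation_nonneg flow_nonneg flow_right_eq_0_iff)

lemma dissipation_nonneg: "finite \<Lambda> \<Longrightarrow> 0 \<le> dissipation \<Lambda> i"
  unfolding dissipation_def by (intro sum_nonneg bond_dissipation_flow_nonneg) auto

text \<open>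
  If \<open>k\<close> belongs to the bond, nothing changes; otherwise each pair of flows splits into two, according to
  whether \<open>k\<close> is occupied, and the log sum inequality applies.
\<close>

lemma dissipation_insert:
  assumes fin: "finite \<Lambda>" shows "dissipation \<Lambda> i \<le> dissipation (insert k \<Lambda>) i"
proof -
  consider "k \<in> \<Lambda>" | "k \<in> {i, i + 1}" | "k \<notin> \<Lambda> \<union> {i, i + 1}" by blast
  then show ?thesis
  proof cases
    case 2
    then have "insert k \<Lambda> - {i, i + 1} = \<Lambda> - {i, i + 1}" "insert k \<Lambda> \<union> {i, i + 1} = \<Lambda> \<union> {i, i + 1}" by auto
    then show ?thesis by (simp add: dissipation_def flow_right_def flow_left_def)
  next
    case 3
    let ?g = "\<lambda>x. bond_dissipation (flow_right (insert k \<Lambda>) i x) (flow_left (insert k \<Lambda>) i x)"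
    have "dissipation \<Lambda> i \<le> (\<Sum>x\<in>Pow (\<Lambda> - {i, i + 1}). ?g x + ?g (insert k x))"
      unfolding dissipation_def
    proof (rule sum_mono)
      fix x assume "x \<in> Pow (\<Lambda> - {i, i + 1})"
      then have x: "x \<subseteq> \<Lambda> - {i, i + 1}" by simp
      then show "bond_dissipation (flow_right \<Lambda> i x) (flow_left \<Lambda> i x) \<le> ?g x + ?g (insert k x)"
        unfolding flow_split[OF fin 3 x] using fin 3
        by (intro bond_dissipation_add flow_nonneg flow_right_eq_0_iff) auto
    qed
    also have "\<dots> = (\<Sum>x\<in>Pow (insert k (\<Lambda> - {i, i + 1})). ?g x)"
      using fin 3 by (intro sum_Pow_insert[symmetric]) auto
    also have "insert k (\<Lambda> - {i, i + 1}) = insert k \<Lambda> - {i, i + 1}" using 3 by auto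
    finally show ?thesis unfolding dissipation_def .
  qed (simp add: insert_absorb)
qed

lemma dissipation_mono:
  assumes "finite \<Lambda>'" "\<Lambda> \<subseteq> \<Lambda>'" shows "dissipation \<Lambda> i \<le> dissipation \<Lambda>' i"
proof -
  have fin: "finite \<Lambda>" using assms finite_subset by blast
  have "dissipation \<Lambda> i \<le> dissipation (\<Lambda> \<union> A) i" if "finite A" for A
    using that
  proof (induction A)
    case (insert k A)
    then show ?case using dissipation_insert[of "\<Lambda> \<union> A" i k] fin by simp
  qed simp
  from this[of "\<Lambda>'"] show ?thesis using assms by (simp add: Un_absorb1)
qed

text \<open>
  Stationarity is tested on the logarithm of the marginal density with respect to the reversible
  weights with logarithms \<open>u\<close>.  Across an interior bond, the increment of the test function is the
  logarithm of the ratio of the two flows, because \<open>u (i + 1) - u i\<close> turns masses into flows.  A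
  bond that straddles the boundary creates or removes a particle at its inner site; there \<open>u\<close> contributes a
  constant times the current.
\<close>

lemma entropy_balance:
  assumes fin: "finite \<Lambda>" and current: "\<And>i. current i = 0"
  shows "(\<Sum>i | i \<in> \<Lambda> \<and> i + 1 \<in> \<Lambda>. dissipation \<Lambda> i)
    = (\<Sum>i | i \<in> \<Lambda> \<longleftrightarrow> i + 1 \<notin> \<Lambda>. \<Sum>x\<in>Pow (\<Lambda> - {i, i + 1}). (flow_right \<Lambda> i x - flow_left \<Lambda> i x)
         * (ln (mass \<Lambda> (\<Lambda> \<inter> insert (i + 1) x)) - ln (mass \<Lambda> (\<Lambda> \<inter> insert i x))))"
proof -
  obtain u where u: "\<And>i. u (i + 1) - u i = ln (p i) - ln (q (i + 1))"
    using ex_int_potential[of "\<lambda>i. ln (p i) - ln (q (i + 1))"] by blast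
  define f where "f \<eta> = ln (mass \<Lambda> {i\<in>\<Lambda>. \<eta> i}) - (\<Sum>i | i \<in> \<Lambda> \<and> \<eta> i. u i)" for \<eta> :: config
  have dep: "depends_on \<Lambda> f"
    unfolding depends_on_def
  proof (intro allI impI)
    fix \<eta> \<zeta> :: config assume "\<forall>i\<in>\<Lambda>. \<eta> i = \<zeta> i"
    then have "{i\<in>\<Lambda>. \<eta> i} = {i\<in>\<Lambda>. \<zeta> i}" by auto
    then show "f \<eta> = f \<zeta>" by (simp add: f_def)
  qed
  have f: "f (config_of y) = ln (mass \<Lambda> (\<Lambda> \<inter> y)) - (\<Sum>i\<in>\<Lambda> \<inter> y. u i)" for y
    by (simp add: f_def Int_def)
  define I where "I = {i. i \<in> \<Lambda> \<and> i + 1 \<in> \<Lambda>}"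
  define B where "B = {i. i \<in> \<Lambda> \<longleftrightarrow> i + 1 \<notin> \<Lambda>}"
  define T where "T i = (\<Sum>x\<in>Pow (\<Lambda> - {i, i + 1}). (flow_right \<Lambda> i x - flow_left \<Lambda> i x)
            * (f (config_of (insert (i + 1) x)) - f (config_of (insert i x))))" for i
  have IB: "bonds \<Lambda> = I \<union> B" "I \<inter> B = {}" "finite I" "finite B"
  proof -
    show 1: "bonds \<Lambda> = I \<union> B" "I \<inter> B = {}" by (auto simp: bonds_def I_def B_def)
    show "finite I" "finite B" using finite_bonds[OF fin] unfolding 1 by auto
  qed
  have "0 = (\<Sum>i\<in>bonds \<Lambda>. T i)"
    unfolding T_def by (rule flow_balance[OF fin dep, symmetric])
  also have "\<dots> = (\<Sum>i\<in>I. T i) + (\<Sum>i\<in>B. T i)"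
    unfolding IB(1) by (rule sum.union_disjoint[OF IB(3,4,2)])
  also have "(\<Sum>i\<in>I. T i) = (\<Sum>i\<in>I. - dissipation \<Lambda> i)"
  proof (rule sum.cong[OF refl])
    fix i assume i: "i \<in> I"
    show "T i = - dissipation \<Lambda> i"
      unfolding T_def dissipation_def sum_negf[symmetric]
    proof (rule sum.cong[OF refl])
      fix x assume "x \<in> Pow (\<Lambda> - {i, i + 1})"
      then have x: "x \<subseteq> \<Lambda> - {i, i + 1}" "finite x" using finite_subset fin by auto
      have eqs: "\<Lambda> \<inter> insert (i + 1) x = insert (i + 1) x" "\<Lambda> \<inter> insert i x = insert i x"
        "{i, i + 1} \<union> \<Lambda> = \<Lambda>"
        using x i unfolding I_def by auto
      have sums: "sum u (insert (i + 1) x) - sum u (insert i x) = u (i + 1) - u i"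
        using x by (subst (1 2) sum.insert) auto
      have iff: "flow_right \<Lambda> i x = 0 \<longleftrightarrow> flow_left \<Lambda> i x = 0"
        by (rule flow_right_eq_0_iff[OF fin x(1)])
      show "(flow_right \<Lambda> i x - flow_left \<Lambda> i x)
            * (f (config_of (insert (i + 1) x)) - f (config_of (insert i x)))
          = - bond_dissipation (flow_right \<Lambda> i x) (flow_left \<Lambda> i x)"
      proof (cases "flow_right \<Lambda> i x = 0")
        case True
        then show ?thesis using iff by (simp add: bond_dissipation_def)
      next
        case False
        have eq: "flow_right \<Lambda> i x = p i * mass \<Lambda> (insert i x)"
          "flow_left \<Lambda> i x = q (i + 1) * mass \<Lambda> (insert (i + 1) x)"
          by (simp_all only: flow_right_def flow_left_def Un_commute[of \<Lambda>] eqs(3))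
        have ne: "mass \<Lambda> (insert i x) \<noteq> 0" "mass \<Lambda> (insert (i + 1) x) \<noteq> 0"
          using False iff unfolding eq by auto
        have "ln (flow_right \<Lambda> i x) - ln (flow_left \<Lambda> i x) = ln (mass \<Lambda> (insert i x))
            - ln (mass \<Lambda> (insert (i + 1) x)) + (ln (p i) - ln (q (i + 1)))"
          unfolding eq using p_pos[of i] q_pos[of "i + 1"] ne
          by (simp add: ln_mult less_le)
        also have "\<dots> = - (f (config_of (insert (i + 1) x)) - f (config_of (insert i x)))"
          unfolding f eqs(1,2) using sums u[of i] by linarith
        finally have ln: "f (config_of (insert (i + 1) x)) - f (config_of (insert i x))
            = - (ln (flow_right \<Lambda> i x) - ln (flow_left \<Lambda> i x))" by linarith
        show ?thesis unfolding ln bond_dissipation_def by (simp add: algebra_simps)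
      qed
    qed
  qed
  also have "(\<Sum>i\<in>B. T i) = (\<Sum>i\<in>B. \<Sum>x\<in>Pow (\<Lambda> - {i, i + 1}). (flow_right \<Lambda> i x - flow_left \<Lambda> i x)
         * (ln (mass \<Lambda> (\<Lambda> \<inter> insert (i + 1) x)) - ln (mass \<Lambda> (\<Lambda> \<inter> insert i x))))"
  proof (rule sum.cong[OF refl])
    fix i assume i: "i \<in> B"
    \<comment> \<open>A jump to the right across the right end removes the particle at \<open>i\<close>; across the left end it
      creates one at \<open>i + 1\<close>.\<close>
    define c where "c = (if i \<in> \<Lambda> then u i else - u (i + 1))"
    have "T i = (\<Sum>x\<in>Pow (\<Lambda> - {i, i + 1}). (flow_right \<Lambda> i x - flow_left \<Lambda> i x)
         * (ln (mass \<Lambda> (\<Lambda> \<inter> insert (i + 1) x)) - ln (mass \<Lambda> (\<Lambda> \<inter> insert i x)))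
         + (flow_right \<Lambda> i x - flow_left \<Lambda> i x) * c)"
      unfolding T_def
    proof (rule sum.cong[OF refl])
      fix x assume "x \<in> Pow (\<Lambda> - {i, i + 1})"
      then have x: "x \<subseteq> \<Lambda>" "i \<notin> x" "i + 1 \<notin> x" "finite x" using finite_subset fin by auto
      have "sum u (\<Lambda> \<inter> insert i x) - sum u (\<Lambda> \<inter> insert (i + 1) x) = c"
        using i x by (auto simp: B_def c_def Int_insert_right Int_absorb1)
      then have "f (config_of (insert (i + 1) x)) - f (config_of (insert i x)) =
         ln (mass \<Lambda> (\<Lambda> \<inter> insert (i + 1) x)) - ln (mass \<Lambda> (\<Lambda> \<inter> insert i x)) + c"
        unfolding f by linarith
      then show "(flow_right \<Lambda> i x - flow_left \<Lambda> i x)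
            * (f (config_of (insert (i + 1) x)) - f (config_of (insert i x)))
          = (flow_right \<Lambda> i x - flow_left \<Lambda> i x)
         * (ln (mass \<Lambda> (\<Lambda> \<inter> insert (i + 1) x)) - ln (mass \<Lambda> (\<Lambda> \<inter> insert i x)))
         + (flow_right \<Lambda> i x - flow_left \<Lambda> i x) * c"
        by (simp only: distrib_left)
    qed
    also have "(\<Sum>x\<in>Pow (\<Lambda> - {i, i + 1}). (flow_right \<Lambda> i x - flow_left \<Lambda> i x) * c) = 0"
      using sum_flow_diff[OF fin, of i] current by (simp flip: sum_distrib_right)
    then have "(\<Sum>x\<in>Pow (\<Lambda> - {i, i + 1}). (flow_right \<Lambda> i x - flow_left \<Lambda> i x)
         * (ln (mass \<Lambda> (\<Lambda> \<inter> insert (i + 1) x)) - ln (mass \<Lambda> (\<Lambda> \<inter> insert i x)))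
         + (flow_right \<Lambda> i x - flow_left \<Lambda> i x) * c)
       = (\<Sum>x\<in>Pow (\<Lambda> - {i, i + 1}). (flow_right \<Lambda> i x - flow_left \<Lambda> i x)
         * (ln (mass \<Lambda> (\<Lambda> \<inter> insert (i + 1) x)) - ln (mass \<Lambda> (\<Lambda> \<inter> insert i x))))"
      by (simp only: sum.distrib add_0_right)
    finally show "T i = (\<Sum>x\<in>Pow (\<Lambda> - {i, i + 1}). (flow_right \<Lambda> i x - flow_left \<Lambda> i x)
         * (ln (mass \<Lambda> (\<Lambda> \<inter> insert (i + 1) x)) - ln (mass \<Lambda> (\<Lambda> \<inter> insert i x))))" .
  qed
  finally show ?thesis by (simp add: sum_negf I_def B_def)
qed

text \<open>
  The configurations before and after a jump across a boundary bond differ exactly at the inner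
  site, so their masses \<open>s\<close> and \<open>t\<close> add up to one over all \<open>x\<close>.
\<close>

lemma boundary_term_le:
  assumes fin: "finite \<Lambda>" and i: "i \<in> \<Lambda> \<longleftrightarrow> i + 1 \<notin> \<Lambda>" and k: "0 < k"
  defines "E \<equiv> \<Sum>x\<in>Pow (\<Lambda> - {i, i + 1}). (flow_right \<Lambda> i x - flow_left \<Lambda> i x)
         * (ln (mass \<Lambda> (\<Lambda> \<inter> insert (i + 1) x)) - ln (mass \<Lambda> (\<Lambda> \<inter> insert i x)))"
  shows "E \<le> dissipation \<Lambda> i / (2 * k) + k" "E \<le> 1"
proof -
  define s where "s x = mass \<Lambda> (\<Lambda> \<inter> insert (i + 1) x)" for x
  define t where "t x = mass \<Lambda> (\<Lambda> \<inter> insert i x)" for x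
  define A where "A = \<Lambda> - {i, i + 1}"
  define j where "j = (if i \<in> \<Lambda> then i else i + 1)"
  have \<Lambda>: "\<Lambda> = insert j A" "j \<notin> A" "finite A" using i fin by (auto simp: A_def j_def)
  have st: "s x + t x = mass \<Lambda> x + mass \<Lambda> (insert j x)" if "x \<in> Pow A" for x
  proof -
    have "x \<subseteq> \<Lambda>" using that by (auto simp: A_def)
    then show ?thesis
      using i by (auto simp: s_def t_def j_def Int_insert_right Int_absorb1)
  qed
  have sum1: "(\<Sum>x\<in>Pow A. s x + t x) = 1"
  proof -
    have "(\<Sum>x\<in>Pow A. s x + t x) = (\<Sum>x\<in>Pow A. mass \<Lambda> x + mass \<Lambda> (insert j x))"
      by (rule sum.cong[OF refl st])
    also have "\<dots> = (\<Sum>x\<in>Pow (insert j A). mass \<Lambda> x)"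
      by (rule sum_Pow_insert[symmetric, OF \<Lambda>(3,2)])
    also have "\<dots> = 1" using sum_mass[OF fin] \<Lambda>(1) by simp
    finally show ?thesis .
  qed
  have E: "E = (\<Sum>x\<in>Pow A. (flow_right \<Lambda> i x - flow_left \<Lambda> i x) * (ln (s x) - ln (t x)))"
    by (simp add: E_def A_def s_def t_def)
  have *: "flow_right \<Lambda> i x = 0 \<longleftrightarrow> flow_left \<Lambda> i x = 0" "flow_right \<Lambda> i x \<le> t x" "flow_left \<Lambda> i x \<le> s x"
    if "x \<in> Pow A" for x
    using that flow_right_eq_0_iff[OF fin, of x i] flow_le_mass[OF fin, of i x]
    by (auto simp: A_def s_def t_def)
  have "E \<le> (\<Sum>x\<in>Pow A. bond_dissipation (flow_right \<Lambda> i x) (flow_left \<Lambda> i x) / (2 * k) + k * (s x + t x))"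
    unfolding E by (intro sum_mono boundary_flow_le(1) flow_nonneg * k)
  also have "\<dots> = (\<Sum>x\<in>Pow A. bond_dissipation (flow_right \<Lambda> i x) (flow_left \<Lambda> i x)) / (2 * k)
      + k * (\<Sum>x\<in>Pow A. s x + t x)"
    by (subst sum.distrib) (simp only: sum_divide_distrib sum_distrib_left)
  also have "\<dots> = dissipation \<Lambda> i / (2 * k) + k"
    unfolding sum1 by (simp add: dissipation_def A_def)
  finally show "E \<le> dissipation \<Lambda> i / (2 * k) + k" .
  have "E \<le> (\<Sum>x\<in>Pow A. s x + t x)"
    unfolding E by (intro sum_mono boundary_flow_le(2)[where k = 1] flow_nonneg *) simp_all
  then show "E \<le> 1" using sum1 by simp
qed

section \<open>Zero current forces detailed balance\<close>

lemma interior_dissipation_le: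
  assumes fin: "finite \<Lambda>" and current: "\<And>i. current i = 0" and k: "0 < k"
  shows "(\<Sum>i | i \<in> \<Lambda> \<and> i + 1 \<in> \<Lambda>. dissipation \<Lambda> i)
      \<le> (\<Sum>i | i \<in> \<Lambda> \<longleftrightarrow> i + 1 \<notin> \<Lambda>. dissipation \<Lambda> i / (2 * k) + k)"
    and "(\<Sum>i | i \<in> \<Lambda> \<and> i + 1 \<in> \<Lambda>. dissipation \<Lambda> i)
      \<le> (\<Sum>i | i \<in> \<Lambda> \<longleftrightarrow> i + 1 \<notin> \<Lambda>. 1)"
proof -
  show "(\<Sum>i | i \<in> \<Lambda> \<and> i + 1 \<in> \<Lambda>. dissipation \<Lambda> i)
      \<le> (\<Sum>i | i \<in> \<Lambda> \<longleftrightarrow> i + 1 \<notin> \<Lambda>. dissipation \<Lambda> i / (2 * k) + k)"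
    unfolding entropy_balance[OF fin current]
    by (intro sum_mono boundary_term_le(1)[OF fin _ k]) simp
  show "(\<Sum>i | i \<in> \<Lambda> \<and> i + 1 \<in> \<Lambda>. dissipation \<Lambda> i)
      \<le> (\<Sum>i | i \<in> \<Lambda> \<longleftrightarrow> i + 1 \<notin> \<Lambda>. 1)"
    unfolding entropy_balance[OF fin current]
    by (intro sum_mono boundary_term_le(2)[OF fin _ k]) simp
qed

text \<open>
  For the total interior dissipation \<open>D n\<close> of \<open>box n\<close> and the dissipation \<open>d n\<close> over its two boundary
  bonds, \<open>D n + d n \<le> D (Suc n)\<close> since the boundary bonds of \<open>box n\<close> are interior to the next box.
  As \<open>D\<close> is bounded, \<open>d\<close> tends to zero, and the bound \<open>D n \<le> d n / (2 * k) + 2 * k\<close> finishes.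
\<close>

lemma dissipation_eq_0:
  assumes current: "\<And>i. current i = 0" and "finite \<Lambda>"
  shows "dissipation \<Lambda> i = 0"
proof -
  define D where "D n = (\<Sum>i\<in>{- int n..<int n}. dissipation (box n) i)" for n
  define d where "d n = dissipation (box n) (- int n - 1) + dissipation (box n) (int n)" for n
  have int: "{i. i \<in> box n \<and> i + 1 \<in> box n} = {- int n..<int n}"
    and bdry: "{i. i \<in> box n \<longleftrightarrow> i + 1 \<notin> box n} = {- int n - 1, int n}" for n
    by (auto simp: box_def)
  have D1: "D n \<le> d n / (2 * k) + 2 * k" if "0 < k" for n k
    using interior_dissipation_le(1)[OF _ current that, of "box n"]
    unfolding int bdry by (simp add: D_def d_def add_divide_distrib)
  have D2: "D n \<le> 2" for n
    using interior_dissipation_le(2)[OF _ current, of "box n" 1]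
    unfolding int bdry by (simp add: D_def)
  have step: "D n + d n \<le> D (Suc n)" for n
  proof -
    have "{- int (Suc n)..<int (Suc n)} = insert (- int n - 1) (insert (int n) {- int n..<int n})"
      by auto
    then have "D n + d n = (\<Sum>i\<in>{- int (Suc n)..<int (Suc n)}. dissipation (box n) i)"
      by (simp add: D_def d_def)
    also have "\<dots> \<le> D (Suc n)"
      unfolding D_def by (intro sum_mono dissipation_mono) (auto simp: box_def)
    finally show ?thesis .
  qed
  have d0: "0 \<le> d n" for n by (simp add: d_def dissipation_nonneg)
  have inc: "incseq D"
    by (rule incseq_SucI) (use step d0 in \<open>smt (verit)\<close>)
  then obtain l where l: "D \<longlonglongrightarrow> l" using D2 by (metis incseq_convergent)
  have le: "D n \<le> 2 * k" if k: "0 < k" for n k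
  proof -
    have "(\<lambda>m. (D (Suc m) - D m) / (2 * k) + 2 * k) \<longlonglongrightarrow> (l - l) / (2 * k) + 2 * k"
      using l k by (intro tendsto_intros LIMSEQ_Suc) auto
    moreover have "D n \<le> (D (Suc m) - D m) / (2 * k) + 2 * k" if "n \<le> m" for m
    proof -
      have "D n \<le> D m" using inc that by (rule incseqD)
      also have "\<dots> \<le> d m / (2 * k) + 2 * k" using k by (rule D1)
      also have "\<dots> \<le> (D (Suc m) - D m) / (2 * k) + 2 * k"
        using step[of m] k by (intro add_right_mono divide_right_mono) auto
      finally show ?thesis .
    qed
    ultimately have "D n \<le> (l - l) / (2 * k) + 2 * k"
      by (intro LIMSEQ_le_const) auto
    then show ?thesis by simp
  qed
  have D0: "D n \<le> 0" for n
  proof (rule field_le_epsilon)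
    fix e :: real assume "0 < e"
    then show "D n \<le> 0 + e" using le[of "e / 2" n] by simp
  qed
  obtain n where n: "\<Lambda> \<union> {i, i + 1} \<subseteq> box n"
    using finite_subset_box[of "\<Lambda> \<union> {i, i + 1}"] assms(2) by auto
  have "dissipation \<Lambda> i \<le> dissipation (box n) i" using n by (intro dissipation_mono) auto
  also have "\<dots> \<le> D n"
    unfolding D_def using n
    by (intro member_le_sum) (auto simp: box_def dissipation_nonneg)
  finally show ?thesis using D0[of n] dissipation_nonneg[OF assms(2), of i] by simp
qed

text \<open>
  A sum of nonnegative dissipations vanishes only if each pair of opposite flows is equal.
\<close>

lemma detailed_balance:
  assumes current: "\<And>i. current i = 0" and fin: "finite \<Lambda>" and x: "x \<subseteq> \<Lambda> - {i, i + 1}"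
  shows "flow_right \<Lambda> i x = flow_left \<Lambda> i x"
proof -
  have "\<forall>x\<in>Pow (\<Lambda> - {i, i + 1}). bond_dissipation (flow_right \<Lambda> i x) (flow_left \<Lambda> i x) = 0"
    using dissipation_eq_0[OF current fin, of i] fin bond_dissipation_flow_nonneg[OF fin]
    unfolding dissipation_def by (subst (asm) sum_nonneg_eq_0_iff) auto
  then show ?thesis
    using x by (intro bond_dissipation_eq_0[OF flow_nonneg flow_right_eq_0_iff[OF fin x]]) auto
qed

text \<open>
  The diagonal parts \<open>bond_rate * f * g\<close> agree trivially; in the jump parts a swap exchanges the
  two configurations of a bond, which carry equal flows.
\<close>

lemma generator_symmetric:
  assumes current: "\<And>i. current i = 0"
    and "finitely_dependent f" "finitely_dependent g"
  shows "(\<integral>\<eta>. f \<eta> * exclusion_generator p q g \<eta> \<partial>\<mu>) = (\<integral>\<eta>. g \<eta> * exclusion_generator p q f \<eta> \<partial>\<mu>)"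
proof -
  obtain A B where "finite A" "depends_on A f" "finite B" "depends_on B g"
    using assms(2,3) by (auto simp: finitely_dependent_iff)
  then obtain \<Lambda> where fin: "finite \<Lambda>" and f: "depends_on \<Lambda> f" and g: "depends_on \<Lambda> g"
    using depends_on_mono[of A f "A \<union> B"] depends_on_mono[of B g "A \<union> B"]
    by (metis finite_UnI sup_ge1 sup_ge2)
  have expand: "(\<integral>\<eta>. u \<eta> * exclusion_generator p q v \<eta> \<partial>\<mu>)
      = (\<Sum>i\<in>bonds \<Lambda>. (\<integral>\<eta>. bond_rate p q i \<eta> * (u \<eta> * v (swap_sites \<eta> i)) \<partial>\<mu>)
                      - (\<integral>\<eta>. bond_rate p q i \<eta> * (u \<eta> * v \<eta>) \<partial>\<mu>))"
    if u: "depends_on \<Lambda> u" and v: "depends_on \<Lambda> v" for u v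
  proof -
    have int: "integrable \<mu> (\<lambda>\<eta>. bond_rate p q i \<eta> * (u \<eta> * v (swap_sites \<eta> i)))"
      "integrable \<mu> (\<lambda>\<eta>. bond_rate p q i \<eta> * (u \<eta> * v \<eta>))" for i
      by (intro integrable_bond_rate[OF fin] depends_on_mult depends_on_swap u v)+
    have "(\<integral>\<eta>. u \<eta> * exclusion_generator p q v \<eta> \<partial>\<mu>)
        = (\<integral>\<eta>. (\<Sum>i\<in>bonds \<Lambda>. bond_rate p q i \<eta> * (u \<eta> * v (swap_sites \<eta> i))
                              - bond_rate p q i \<eta> * (u \<eta> * v \<eta>)) \<partial>\<mu>)"
      by (simp add: exclusion_generator_eq_sum[OF fin v] sum_distrib_left algebra_simps)
    also have "\<dots> = (\<Sum>i\<in>bonds \<Lambda>. (\<integral>\<eta>. bond_rate p q i \<eta> * (u \<eta> * v (swap_sites \<eta> i)) \<partial>\<mu>)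
                      - (\<integral>\<eta>. bond_rate p q i \<eta> * (u \<eta> * v \<eta>) \<partial>\<mu>))"
      by (subst Bochner_Integration.integral_sum)
        (simp_all add: int Bochner_Integration.integral_diff)
    finally show ?thesis .
  qed
  have sym: "(\<integral>\<eta>. bond_rate p q i \<eta> * (f \<eta> * g (swap_sites \<eta> i)) \<partial>\<mu>)
      = (\<integral>\<eta>. bond_rate p q i \<eta> * (g \<eta> * f (swap_sites \<eta> i)) \<partial>\<mu>)" for i
  proof -
    have dep: "depends_on (\<Lambda> \<union> {i, i + 1}) (\<lambda>\<eta>. f \<eta> * g (swap_sites \<eta> i))"
      "depends_on (\<Lambda> \<union> {i, i + 1}) (\<lambda>\<eta>. g \<eta> * f (swap_sites \<eta> i))"
      by (intro depends_on_mult depends_on_swap f g)+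
    show ?thesis
      unfolding integral_bond_rate[OF fin dep(1)] integral_bond_rate[OF fin dep(2)]
    proof (rule sum.cong[OF refl])
      fix x assume "x \<in> Pow (\<Lambda> - {i, i + 1})"
      then have x: "x \<subseteq> \<Lambda> - {i, i + 1}" by simp
      have *: "swap_sites (config_of (insert i x)) i = config_of (insert (i + 1) x)"
         "swap_sites (config_of (insert (i + 1) x)) i = config_of (insert i x)"
        by (rule swap_config_of; use x in auto)+
      show "flow_right \<Lambda> i x * (f (config_of (insert i x)) * g (swap_sites (config_of (insert i x)) i))
          + flow_left \<Lambda> i x * (f (config_of (insert (i + 1) x)) * g (swap_sites (config_of (insert (i + 1) x)) i))
          = flow_right \<Lambda> i x * (g (config_of (insert i x)) * f (swap_sites (config_of (insert i x)) i))
          + flow_left \<Lambda> i x * (g (config_of (insert (i + 1) x)) * f (swap_sites (config_of (insert (i + 1) x)) i))"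
        unfolding * detailed_balance[OF current fin x] by (simp only: ac_simps)
    qed
  qed
  show ?thesis
    unfolding expand[OF f g] expand[OF g f] sym by (simp add: mult.commute[of "f _" "g _"])
qed

end

section \<open>Markov semigroups\<close>

lemma markov_semigroupD:
  assumes "markov_semigroup S"
  shows "0 \<le> t \<Longrightarrow> linear (S t)" "S 0 f = f"
    "0 \<le> s \<Longrightarrow> 0 \<le> t \<Longrightarrow> S (s + t) f = S s (S t f)"
    "0 \<le> t \<Longrightarrow> S t (const_bcontfun 1) = const_bcontfun 1"
    "0 \<le> t \<Longrightarrow> (\<And>x. 0 \<le> apply_bcontfun f x) \<Longrightarrow> 0 \<le> apply_bcontfun (S t f) x"
    "((\<lambda>t. S t f) \<longlongrightarrow> f) (at_right 0)"
  using assms unfolding markov_semigroup_def by blast+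

text \<open>
  Positivity applied to \<open>norm f - f\<close> and \<open>norm f + f\<close>, and invariance of constants.
\<close>

lemma markov_semigroup_norm_le:
  fixes S :: "real \<Rightarrow> ('a::topological_space \<Rightarrow>\<^sub>C real) \<Rightarrow> ('a \<Rightarrow>\<^sub>C real)"
  assumes "markov_semigroup S" "0 \<le> t"
  shows "norm (S t f) \<le> norm f"
proof (rule norm_bound)
  fix x
  note lin = markov_semigroupD(1)[OF assms]
  let ?c = "norm f *\<^sub>R const_bcontfun 1 :: 'a \<Rightarrow>\<^sub>C real"
  have c: "S t ?c = ?c"
    using linear_scale[OF lin] markov_semigroupD(4)[OF assms] by metis
  have f: "\<bar>apply_bcontfun f y\<bar> \<le> norm f" for y
    using norm_bounded[of f y] by simp
  have "0 \<le> apply_bcontfun (S t (?c - f)) x"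
    using f by (intro markov_semigroupD(5)[OF assms]) (simp add: abs_le_iff)
  moreover have "0 \<le> apply_bcontfun (S t (?c + f)) x"
  proof (rule markov_semigroupD(5)[OF assms])
    fix y
    have "0 \<le> norm f + apply_bcontfun f y" using f[of y] by linarith
    then show "0 \<le> apply_bcontfun (?c + f) y" by simp
  qed
  ultimately show "norm (apply_bcontfun (S t f) x) \<le> norm f"
    unfolding linear_diff[OF lin] linear_add[OF lin] c by (simp add: abs_le_iff)
qed

lemma semigroup_derivative_bound:
  assumes S: "markov_semigroup S" and t: "0 \<le> t" and h: "0 < h"
  shows "norm (S (t + h) f - S t f - h *\<^sub>R S t g) \<le> h * norm ((1 / h) *\<^sub>R (S h f - f) - g)"
proof -
  note lin = markov_semigroupD(1)[OF S t]
  have "S (t + h) f - S t f - h *\<^sub>R S t g = S t (S h f - f - h *\<^sub>R g)"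
    using markov_semigroupD(3)[OF S t, of h] h
    by (simp add: linear_diff[OF lin] linear_scale[OF lin])
  also have "norm \<dots> \<le> norm (S h f - f - h *\<^sub>R g)"
    by (rule markov_semigroup_norm_le[OF S t])
  also have "S h f - f - h *\<^sub>R g = h *\<^sub>R ((1 / h) *\<^sub>R (S h f - f) - g)"
    using h by (simp add: scaleR_right_diff_distrib)
  finally show ?thesis using h by simp
qed

text \<open>
  The generator is given by a one-sided limit at time zero.  For an increment \<open>h\<close> to the left of \<open>t\<close>
  the derivative is first obtained at \<open>t - h\<close>, and the contraction property bounds the
  difference between \<open>S (t - h) g\<close> and \<open>S t g\<close> by \<open>norm (S h g - g)\<close>.
\<close>

lemma semigroup_has_vector_derivative:
  assumes S: "markov_semigroup S" and fg: "(f, g) \<in> generator_graph S" and t: "0 < t"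
  shows "((\<lambda>s. S s f) has_vector_derivative S t g) (at t)"
proof -
  define r where "r h = norm ((1 / h) *\<^sub>R (S h f - f) - g) + norm (S h g - g)" for h
  have "((\<lambda>h. (1 / h) *\<^sub>R (S h f - f)) \<longlongrightarrow> g) (at_right 0)"
    using fg by (simp add: generator_graph_def)
  then have "(r \<longlongrightarrow> norm (g - g) + norm (g - g)) (at_right 0)"
    unfolding r_def by (intro tendsto_intros markov_semigroupD(6)[OF S])
  then have r0: "(r \<longlongrightarrow> 0) (at_right 0)" by simp
  have fwd: "norm (S (s + h) f - S s f - h *\<^sub>R S s g) \<le> h * norm ((1 / h) *\<^sub>R (S h f - f) - g)"
    if "0 \<le> s" "0 < h" for s h
    by (rule semigroup_derivative_bound[OF S that])
  have bound: "norm (S s f - S t f - (s - t) *\<^sub>R S t g) \<le> \<bar>s - t\<bar> * r \<bar>s - t\<bar>"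
    if s: "0 \<le> s" "s \<noteq> t" for s
  proof (cases "t < s")
    case True
    have "norm (S s f - S t f - (s - t) *\<^sub>R S t g)
        \<le> (s - t) * norm ((1 / (s - t)) *\<^sub>R (S (s - t) f - f) - g)"
      using fwd[of t "s - t"] t True by simp
    also have "\<dots> \<le> \<bar>s - t\<bar> * r \<bar>s - t\<bar>"
      using True by (simp add: r_def distrib_left)
    finally show ?thesis .
  next
    case False
    define h where "h = t - s"
    have h: "0 < h" "t = s + h" "\<bar>s - t\<bar> = h" using False s by (auto simp: h_def)
    note lin = markov_semigroupD(1)[OF S s(1)]
    have "norm (S t g - S s g) \<le> norm (S h g - g)"
      using markov_semigroup_norm_le[OF S s(1), of "S h g - g"] h
        markov_semigroupD(3)[OF S s(1), of h] by (simp add: linear_diff[OF lin])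
    then have "norm (h *\<^sub>R (S t g - S s g)) \<le> h * norm (S h g - g)"
      using h by simp
    moreover have "S s f - S t f - (s - t) *\<^sub>R S t g
        = h *\<^sub>R (S t g - S s g) - (S (s + h) f - S s f - h *\<^sub>R S s g)"
      by (simp add: h(2) scaleR_right_diff_distrib)
    ultimately have "norm (S s f - S t f - (s - t) *\<^sub>R S t g)
        \<le> h * norm (S h g - g) + h * norm ((1 / h) *\<^sub>R (S h f - f) - g)"
      using fwd[OF s(1) h(1)] by (metis order_trans[OF norm_triangle_ineq4 add_mono])
    then show ?thesis unfolding h(3) r_def by (simp add: distrib_left)
  qed
  show ?thesis
    unfolding has_vector_derivative_def has_derivative_at_alt
  proof (intro conjI bounded_linear_scaleR_left allI impI)
    fix e :: real assume "0 < e"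
    then have "\<forall>\<^sub>F h in at_right 0. r h < e" using r0 by (rule order_tendstoD(2)[rotated])
    then obtain d where d: "0 < d" "\<And>h. 0 < h \<Longrightarrow> h < d \<Longrightarrow> r h < e"
      unfolding eventually_at_right_field by auto
    show "\<exists>d>0. \<forall>y. norm (y - t) < d \<longrightarrow>
        norm (S y f - S t f - (y - t) *\<^sub>R S t g) \<le> e * norm (y - t)"
    proof (intro exI[of _ "min d t"] conjI allI impI)
      fix y assume y: "norm (y - t) < min d t"
      show "norm (S y f - S t f - (y - t) *\<^sub>R S t g) \<le> e * norm (y - t)"
      proof (cases "y = t")
        case False
        have "norm (S y f - S t f - (y - t) *\<^sub>R S t g) \<le> \<bar>y - t\<bar> * r \<bar>y - t\<bar>"
          using y False by (intro bound) auto
        also have "\<dots> \<le> \<bar>y - t\<bar> * e"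
          using y False by (intro mult_left_mono less_imp_le[OF d(2)]) auto
        finally show ?thesis by (simp add: mult.commute)
      qed simp
    qed (use d t in auto)
  qed
qed

lemma semigroup_continuous_on:
  assumes S: "markov_semigroup S" and fg: "(f, g) \<in> generator_graph S" and "0 < b"
  shows "continuous_on {0..b} (\<lambda>s. S s f)"
  unfolding continuous_on_eq_continuous_within
proof
  fix s assume s: "s \<in> {0..b}"
  show "continuous (at s within {0..b}) (\<lambda>s. S s f)"
  proof (cases "s = 0")
    case True
    have "((\<lambda>s. S s f) \<longlongrightarrow> S 0 f) (at_right 0)"
      using markov_semigroupD(2,6)[OF S] by simp
    then show ?thesis
      using True \<open>0 < b\<close> by (simp add: continuous_within at_within_Icc_at_right)
  next
    case False
    then have "((\<lambda>s. S s f) has_vector_derivative S s g) (at s)"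
      using s by (intro semigroup_has_vector_derivative[OF S fg]) auto
    then show ?thesis
      by (rule continuous_at_imp_continuous_at_within[OF has_vector_derivative_continuous])
  qed
qed

text \<open>
  By induction on \<open>n\<close>: the derivative of the remainder for \<open>F\<close> is the remainder of lower order for the
  shifted sequence, so the mean value inequality integrates the bound.  That inequality asks for
  derivatives at positive times and for mere continuity at time zero.
\<close>

lemma semigroup_taylor:
  assumes S: "markov_semigroup S" and F: "\<And>k. (F k, F (Suc k)) \<in> generator_graph S" and t: "0 \<le> t"
  shows "norm (S t (F 0) - (\<Sum>k<n. (t ^ k / fact k) *\<^sub>R F k)) \<le> t ^ n / fact n * norm (F n)"
  using F t
proof (induction n arbitrary: F t)
  case 0
  then show ?case using markov_semigroup_norm_le[OF S] by simp
next
  case (Suc n)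
  define R where "R s = S s (F 0) - (\<Sum>k<Suc n. (s ^ k / fact k) *\<^sub>R F k)" for s
  define R' where "R' s = S s (F (Suc 0)) - (\<Sum>k<n. (s ^ k / fact k) *\<^sub>R F (Suc k))" for s
  define \<phi> where "\<phi> s = s ^ Suc n / fact (Suc n) * norm (F (Suc n))" for s :: real
  define \<phi>' where "\<phi>' s = s ^ n / fact n * norm (F (Suc n))" for s :: real
  have R: "R s = S s (F 0) - (F 0 + (\<Sum>k<n. (s ^ Suc k / fact (Suc k)) *\<^sub>R F (Suc k)))" for s
    unfolding R_def sum.lessThan_Suc_shift by simp
  have R0: "R 0 = 0" unfolding R by (simp add: markov_semigroupD(2)[OF S])
  have pow: "((\<lambda>s. s ^ Suc k / fact (Suc k)) has_real_derivative s ^ k / fact k) (at s)" for k and s :: real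
    by (rule derivative_eq_intros refl | simp)+
  show ?case
  proof (cases "t = 0")
    case True
    then show ?thesis using R0 by (simp add: R_def)
  next
    case False
    then have t: "0 < t" using Suc.prems by simp
    have "norm (R t - R 0) \<le> \<phi> t - \<phi> 0"
    proof (rule differentiable_bound_general[OF t, where f' = R' and \<phi>' = \<phi>'])
      show "continuous_on {0..t} R"
        unfolding R_def
        by (intro continuous_intros semigroup_continuous_on[OF S Suc.prems(1) t]) simp
      show "continuous_on {0..t} \<phi>" unfolding \<phi>_def by (intro continuous_intros) simp
    next
      fix s :: real assume s: "0 < s" "s < t"
      show "(R has_vector_derivative R' s) (at s)"
        unfolding R[abs_def] R'_def
        by (rule derivative_eq_intros semigroup_has_vector_derivative[OF S Suc.prems(1) s(1)]
            pow has_vector_derivative_sum has_vector_derivative_scaleR refl | simp)+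
      show "(\<phi> has_vector_derivative \<phi>' s) (at s)"
        unfolding \<phi>_def \<phi>'_def has_real_derivative_iff_has_vector_derivative[symmetric]
        by (intro DERIV_cmult_right pow)
      show "norm (R' s) \<le> \<phi>' s"
        unfolding R'_def \<phi>'_def using Suc.IH[of "\<lambda>k. F (Suc k)" s] Suc.prems s by simp
    qed
    then show ?thesis using R0 by (simp add: R_def \<phi>_def)
  qed
qed

section \<open>Analyticity of the semigroup for short times\<close>

text \<open>
  The generator as an operator on the Banach space, so that it can be iterated.  The image of a
  function of finitely many sites is again one, hence bounded and continuous, so that
  \<open>Bcontfun\<close> does not change its values.
\<close>

definition generator_bcontfun ::
  "(int \<Rightarrow> real) \<Rightarrow> (int \<Rightarrow> real) \<Rightarrow> (config \<Rightarrow>\<^sub>C real) \<Rightarrow> (config \<Rightarrow>\<^sub>C real)" where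
  "generator_bcontfun p q f = Bcontfun (exclusion_generator p q (apply_bcontfun f))"

lemma exclusion_semigroup_generator:
  assumes "exclusion_semigroup p q S" "finitely_dependent (apply_bcontfun f)"
  shows "apply_bcontfun (generator_bcontfun p q f) = exclusion_generator p q (apply_bcontfun f)"
    and "(f, generator_bcontfun p q f) \<in> generator_graph S"
proof -
  obtain g where g: "apply_bcontfun g = exclusion_generator p q (apply_bcontfun f)"
    "(f, g) \<in> generator_graph S"
    using assms unfolding exclusion_semigroup_def by blast
  have "generator_bcontfun p q f = g"
    unfolding generator_bcontfun_def g(1)[symmetric] by (rule apply_bcontfun_inverse)
  with g show "apply_bcontfun (generator_bcontfun p q f) = exclusion_generator p q (apply_bcontfun f)"
    and "(f, generator_bcontfun p q f) \<in> generator_graph S" by auto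
qed

text \<open>
  Each application of the generator enlarges the box by one site on both sides, and therefore
  multiplies the norm by at most a constant times the size of the box reached so far.
\<close>

lemma generator_iterates:
  assumes S: "exclusion_semigroup p q S"
    and rates: "\<And>i. 0 \<le> p i \<and> p i \<le> 1" "\<And>i. 0 \<le> q i \<and> q i \<le> 1"
    and f: "depends_on (box m) (apply_bcontfun f)"
  defines "F \<equiv> \<lambda>k. (generator_bcontfun p q ^^ k) f"
  shows "depends_on (box (m + k)) (apply_bcontfun (F k))"
    and "(F k, F (Suc k)) \<in> generator_graph S"
    and "norm (F k) * fact m \<le> 4 ^ k * fact (m + k) * norm f"
proof -
  have dep: "depends_on (box (m + k)) (apply_bcontfun (F k))" for k
  proof (induction k)
    case (Suc k)
    then have "finitely_dependent (apply_bcontfun (F k))"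
      by (rule depends_on_box_imp_finitely_dependent)
    from exclusion_semigroup_generator(1)[OF S this] generator_depends_on[OF Suc]
    show ?case by (simp add: F_def)
  qed (simp add: F_def f)
  have fd: "finitely_dependent (apply_bcontfun (F k))" for k
    by (rule depends_on_box_imp_finitely_dependent[OF dep])
  show "depends_on (box (m + k)) (apply_bcontfun (F k))" by (rule dep)
  show "(F k, F (Suc k)) \<in> generator_graph S"
    using exclusion_semigroup_generator(2)[OF S fd[of k]] by (simp add: F_def)
  show "norm (F k) * fact m \<le> 4 ^ k * fact (m + k) * norm f"
  proof (induction k)
    case (Suc k)
    have "norm (F (Suc k)) \<le> 4 * real (Suc (m + k)) * norm (F k)"
    proof (rule norm_bound)
      fix \<eta>
      have "\<bar>exclusion_generator p q (apply_bcontfun (F k)) \<eta>\<bar> \<le> 4 * real (Suc (m + k)) * norm (F k)"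
        by (rule generator_bound[OF dep _ rates]) (metis norm_bounded real_norm_def)
      then show "norm (apply_bcontfun (F (Suc k)) \<eta>) \<le> 4 * real (Suc (m + k)) * norm (F k)"
        using exclusion_semigroup_generator(1)[OF S fd[of k]] by (simp add: F_def)
    qed
    then have "norm (F (Suc k)) * fact m \<le> 4 * real (Suc (m + k)) * norm (F k) * fact m"
      by (intro mult_right_mono) auto
    also have "\<dots> = 4 * real (Suc (m + k)) * (norm (F k) * fact m)" by (simp only: mult.assoc)
    also have "\<dots> \<le> 4 * real (Suc (m + k)) * (4 ^ k * fact (m + k) * norm f)"
      by (intro mult_left_mono Suc.IH) simp
    also have "\<dots> = 4 ^ Suc k * fact (m + Suc k) * norm f" by (simp add: algebra_simps)
    finally show ?case .
  qed (simp add: F_def)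
qed

text \<open>
  Functions of finitely many sites are analytic vectors, with a radius of convergence that does
  not depend on the function: if \<open>f\<close> depends on \<open>box m\<close>, then \<open>t ^ n / fact n * norm (L ^ n f)\<close> is at most
  \<open>norm f * (4 * t) ^ n\<close> times the binomial coefficient of \<open>m + n\<close> over \<open>n\<close>, hence at most
  \<open>2 ^ m * norm f * (8 * t) ^ n\<close>.
\<close>

lemma exclusion_semigroup_taylor_tendsto:
  assumes S: "exclusion_semigroup p q S"
    and rates: "\<And>i. 0 \<le> p i \<and> p i \<le> 1" "\<And>i. 0 \<le> q i \<and> q i \<le> 1"
    and f: "finitely_dependent (apply_bcontfun f)" and t: "0 \<le> t" "t < 1 / 8"
  shows "(\<lambda>n. \<Sum>k<n. (t ^ k / fact k) *\<^sub>R (generator_bcontfun p q ^^ k) f) \<longlonglongrightarrow> S t f"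
proof -
  obtain m where dep: "depends_on (box m) (apply_bcontfun f)"
    using f by (rule finitely_dependentE)
  define F where "F k = (generator_bcontfun p q ^^ k) f" for k
  note it = generator_iterates[OF S rates dep, folded F_def]
  have M: "markov_semigroup S" using S by (simp add: exclusion_semigroup_def)
  have "norm (S t f - (\<Sum>k<n. (t ^ k / fact k) *\<^sub>R F k)) \<le> 2 ^ m * norm f * (8 * t) ^ n" for n
  proof -
    have fact: "fact (m + n) = (fact m * fact n * real ((m + n) choose n) :: real)"
      using binomial_fact[of n "m + n", where 'a = real] by (simp add: field_simps)
    have "norm (F n) * fact m \<le> 4 ^ n * fact (m + n) * norm f" by (rule it(3))
    also have "\<dots> = (4 ^ n * fact n * real ((m + n) choose n) * norm f) * fact m"
      by (simp add: fact)
    finally have "norm (F n) \<le> 4 ^ n * fact n * real ((m + n) choose n) * norm f"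
      by (rule mult_right_le_imp_le) simp
    also have "\<dots> \<le> 4 ^ n * fact n * 2 ^ (m + n) * norm f"
      using binomial_le_pow2[of "m + n" n]
      by (intro mult_right_mono mult_left_mono) (simp_all add: of_nat_le_iff[of _ "2 ^ (m + n)", simplified])
    finally have N: "norm (F n) \<le> 4 ^ n * fact n * 2 ^ (m + n) * norm f" .
    have "norm (S t f - (\<Sum>k<n. (t ^ k / fact k) *\<^sub>R F k)) \<le> t ^ n / fact n * norm (F n)"
      using semigroup_taylor[of S F t n, OF M it(2) t(1)] by (simp add: F_def)
    also have "\<dots> \<le> t ^ n / fact n * (4 ^ n * fact n * 2 ^ (m + n) * norm f)"
      using t N by (intro mult_left_mono) auto
    also have "\<dots> = 2 ^ m * norm f * (8 * t) ^ n"
      using power_mult_distrib[of "4::real" 2 n] by (simp add: power_add power_mult_distrib)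
    finally show ?thesis .
  qed
  note bound = this
  have "(\<lambda>n. 2 ^ m * norm f * (8 * t) ^ n) \<longlonglongrightarrow> 2 ^ m * norm f * 0"
    using t by (intro tendsto_mult_left LIMSEQ_power_zero) simp
  then have lim: "(\<lambda>n. 2 ^ m * norm f * (8 * t) ^ n) \<longlonglongrightarrow> 0" by simp
  have "(\<lambda>n. S t f - (\<Sum>k<n. (t ^ k / fact k) *\<^sub>R F k)) \<longlonglongrightarrow> 0"
    by (rule Lim_null_comparison[OF always_eventually[OF allI[OF bound]] lim])
  from tendsto_diff[OF tendsto_const[of "S t f"] this] show ?thesis
    by (simp add: F_def)
qed

section \<open>Density of the finitely dependent functions\<close>

lemma compact_config: "compact (UNIV :: config set)"
proof -
  have "compact (UNIV :: bool set)" by (rule finite_imp_compact) simp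
  then have "compact_space (euclidean :: bool topology)"
    by (simp add: compact_space_def)
  then have "compact_space (product_topology (\<lambda>_::int. euclidean :: bool topology) UNIV)"
    by (simp add: compact_space_product_topology)
  then show ?thesis
    by (simp add: euclidean_product_topology compact_space_def)
qed

lemma open_config_contains_cylinder:
  fixes U :: "config set"
  assumes "open U" "\<eta> \<in> U"
  obtains A where "finite A" "\<And>\<zeta>. (\<forall>i\<in>A. \<zeta> i = \<eta> i) \<Longrightarrow> \<zeta> \<in> U"
proof -
  have "openin (product_topology (\<lambda>_::int. euclidean :: bool topology) UNIV) U"
    using assms(1) by (simp add: euclidean_product_topology)
  then obtain X where X: "finite {i. X i \<noteq> (UNIV :: bool set)}" "\<eta> \<in> Pi\<^sub>E UNIV X" "Pi\<^sub>E UNIV X \<subseteq> U"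
    using assms(2) unfolding openin_product_topology_alt by fastforce
  have "\<zeta> \<in> U" if "\<forall>i\<in>{i. X i \<noteq> UNIV}. \<zeta> i = \<eta> i" for \<zeta>
  proof -
    have "\<zeta> i \<in> X i" for i using X(2) that by (cases "X i = UNIV") (auto simp: PiE_UNIV_domain)
    then show ?thesis using X(3) by (auto simp: PiE_UNIV_domain)
  qed
  then show ?thesis using X(1) that by blast
qed

text \<open>
  By compactness finitely many cylinders, on each of which \<open>f\<close> varies by less than \<open>e\<close>, cover the
  space.  If \<open>\<Lambda>\<close> collects their sites, emptying all sites outside \<open>\<Lambda>\<close> keeps a configuration in its
  cylinder, so this operation changes \<open>f\<close> by at most \<open>e\<close>.
\<close>

lemma finitely_dependent_dense:
  fixes f :: "config \<Rightarrow>\<^sub>C real"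
  assumes "0 < e"
  obtains g where "finitely_dependent (apply_bcontfun g)" "norm (f - g) \<le> e"
proof -
  define N where "N \<eta> A = {\<zeta>::config. \<forall>i\<in>A. \<zeta> i = \<eta> i}" for \<eta> and A :: "int set"
  have "\<exists>A. finite A \<and> (\<forall>\<zeta>\<in>N \<eta> A. \<bar>apply_bcontfun f \<zeta> - apply_bcontfun f \<eta>\<bar> < e / 2)" for \<eta>
  proof -
    have "open (apply_bcontfun f -` ball (apply_bcontfun f \<eta>) (e / 2))"
      by (intro open_vimage) auto
    moreover have "\<eta> \<in> apply_bcontfun f -` ball (apply_bcontfun f \<eta>) (e / 2)" using assms by simp
    ultimately obtain A where "finite A"
      "\<And>\<zeta>. (\<forall>i\<in>A. \<zeta> i = \<eta> i) \<Longrightarrow> \<zeta> \<in> apply_bcontfun f -` ball (apply_bcontfun f \<eta>) (e / 2)"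
      by (rule open_config_contains_cylinder) blast
    then show ?thesis by (intro exI[of _ A]) (auto simp: N_def dist_real_def abs_minus_commute)
  qed
  then obtain A where A: "\<And>\<eta>. finite (A \<eta>)"
    "\<And>\<eta> \<zeta>. \<zeta> \<in> N \<eta> (A \<eta>) \<Longrightarrow> \<bar>apply_bcontfun f \<zeta> - apply_bcontfun f \<eta>\<bar> < e / 2"
    by metis
  have "\<And>\<eta>. open (N \<eta> (A \<eta>))" unfolding N_def by (rule open_agree[OF A(1)])
  moreover have "UNIV \<subseteq> (\<Union>\<eta>. N \<eta> (A \<eta>))" by (auto simp: N_def)
  ultimately obtain C where C: "finite C" "UNIV \<subseteq> (\<Union>\<eta>\<in>C. N \<eta> (A \<eta>))"
    using compactE_image[OF compact_config, of UNIV "\<lambda>\<eta>. N \<eta> (A \<eta>)"] by auto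
  define \<Lambda> where "\<Lambda> = (\<Union>\<eta>\<in>C. A \<eta>)"
  have fin: "finite \<Lambda>" using C(1) A(1) by (simp add: \<Lambda>_def)
  define g where "g \<zeta> = apply_bcontfun f (config_of {i\<in>\<Lambda>. \<zeta> i})" for \<zeta> :: config
  have g: "depends_on \<Lambda> g"
    unfolding depends_on_def
  proof (intro allI impI)
    fix \<eta> \<zeta> :: config assume "\<forall>i\<in>\<Lambda>. \<eta> i = \<zeta> i"
    then have "{i\<in>\<Lambda>. \<eta> i} = {i\<in>\<Lambda>. \<zeta> i}" by auto
    then show "g \<eta> = g \<zeta>" by (simp add: g_def)
  qed
  have app: "apply_bcontfun (Bcontfun g) = g"
    by (rule Bcontfun_inverse[OF depends_on_bcontfun[OF fin g]])
  show ?thesis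
  proof (rule that[of "Bcontfun g"])
    show "finitely_dependent (apply_bcontfun (Bcontfun g))"
      using fin g by (auto simp: app finitely_dependent_iff)
    show "norm (f - Bcontfun g) \<le> e"
    proof (rule norm_bound)
      fix \<zeta>
      obtain \<eta> where \<eta>: "\<eta> \<in> C" "\<zeta> \<in> N \<eta> (A \<eta>)" using C(2) by blast
      then have "config_of {i\<in>\<Lambda>. \<zeta> i} \<in> N \<eta> (A \<eta>)" by (auto simp: N_def \<Lambda>_def)
      then have "\<bar>g \<zeta> - apply_bcontfun f \<eta>\<bar> < e / 2" unfolding g_def by (rule A(2))
      moreover have "\<bar>apply_bcontfun f \<zeta> - apply_bcontfun f \<eta>\<bar> < e / 2" using \<eta>(2) by (rule A(2))
      ultimately have "\<bar>apply_bcontfun f \<zeta> - g \<zeta>\<bar> \<le> e" by linarith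
      then show "norm (apply_bcontfun (f - Bcontfun g) \<zeta>) \<le> e" by (simp add: app)
    qed
  qed
qed

section \<open>From the generator to the semigroup\<close>

lemma bounded_bilinear_integral_mult:
  fixes \<mu> :: "'a::topological_space measure"
  assumes "prob_space \<mu>" "sets \<mu> = sets borel"
  shows "bounded_bilinear (\<lambda>f g :: 'a \<Rightarrow>\<^sub>C real. \<integral>\<eta>. apply_bcontfun f \<eta> * apply_bcontfun g \<eta> \<partial>\<mu>)"
proof -
  interpret prob_space \<mu> by fact
  have meas: "apply_bcontfun f \<in> borel_measurable \<mu>" for f :: "'a \<Rightarrow>\<^sub>C real"
    using borel_measurable_continuous_onI[OF continuous_on_apply_bcontfun[of UNIV f]] assms(2)
    by (simp cong: measurable_cong_sets)
  have bound: "norm (apply_bcontfun f \<eta> * apply_bcontfun g \<eta>) \<le> norm f * norm g"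
    for f g :: "'a \<Rightarrow>\<^sub>C real" and \<eta>
    unfolding norm_mult by (intro mult_mono norm_bounded) auto
  have int: "integrable \<mu> (\<lambda>\<eta>. apply_bcontfun f \<eta> * apply_bcontfun g \<eta>)" for f g :: "'a \<Rightarrow>\<^sub>C real"
    by (rule integrable_const_bound[where B = "norm f * norm g"])
      (use bound meas in auto)
  show ?thesis
  proof
    show "\<exists>K. \<forall>f g :: 'a \<Rightarrow>\<^sub>C real.
        norm (\<integral>\<eta>. apply_bcontfun f \<eta> * apply_bcontfun g \<eta> \<partial>\<mu>) \<le> norm f * norm g * K"
    proof (intro exI[of _ 1] allI)
      fix f g :: "'a \<Rightarrow>\<^sub>C real"
      have "norm (\<integral>\<eta>. apply_bcontfun f \<eta> * apply_bcontfun g \<eta> \<partial>\<mu>)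
          \<le> (\<integral>\<eta>. norm (apply_bcontfun f \<eta> * apply_bcontfun g \<eta>) \<partial>\<mu>)"
        by (rule integral_norm_bound)
      also have "\<dots> \<le> (\<integral>\<eta>. norm f * norm g \<partial>\<mu>)"
        by (intro integral_mono integrable_norm int bound) simp
      finally show "norm (\<integral>\<eta>. apply_bcontfun f \<eta> * apply_bcontfun g \<eta> \<partial>\<mu>) \<le> norm f * norm g * 1"
        by (simp add: prob_space)
    qed
  qed (simp_all add: int distrib_left distrib_right mult.assoc mult.left_commute)
qed

text \<open>
  The integral is continuous in the supremum norm and constant along the semigroup.
\<close>

lemma stationary_imp_integral_generator_eq_0:
  fixes S :: "real \<Rightarrow> ('a::topological_space \<Rightarrow>\<^sub>C real) \<Rightarrow> ('a \<Rightarrow>\<^sub>C real)"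
  assumes "\<mu> \<in> stationary_distributions S" and fg: "(f, g) \<in> generator_graph S"
  shows "(\<integral>\<eta>. apply_bcontfun g \<eta> \<partial>\<mu>) = 0"
proof -
  have \<mu>: "prob_space \<mu>" "sets \<mu> = sets borel"
    and stat: "\<And>t f. 0 \<le> t \<Longrightarrow> (\<integral>\<eta>. apply_bcontfun (S t f) \<eta> \<partial>\<mu>) = (\<integral>\<eta>. apply_bcontfun f \<eta> \<partial>\<mu>)"
    using assms(1) by (auto simp: stationary_distributions_def)
  let ?B = "\<lambda>f g :: 'a \<Rightarrow>\<^sub>C real. \<integral>\<eta>. apply_bcontfun f \<eta> * apply_bcontfun g \<eta> \<partial>\<mu>"
  interpret B: bounded_bilinear ?B by (rule bounded_bilinear_integral_mult[OF \<mu>])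
  let ?one = "const_bcontfun 1 :: 'a \<Rightarrow>\<^sub>C real"
  have "((\<lambda>t. (1 / t) *\<^sub>R (S t f - f)) \<longlongrightarrow> g) (at_right 0)"
    using fg by (simp add: generator_graph_def)
  then have lim: "((\<lambda>t. ?B ((1 / t) *\<^sub>R (S t f - f)) ?one) \<longlongrightarrow> ?B g ?one) (at_right 0)"
    by (intro B.tendsto tendsto_const)
  have "\<forall>\<^sub>F t in at_right 0. ?B ((1 / t) *\<^sub>R (S t f - f)) ?one = 0"
    using eventually_at_right_less
  proof eventually_elim
    case (elim t)
    have "?B ((1 / t) *\<^sub>R (S t f - f)) ?one = (1 / t) * (?B (S t f) ?one - ?B f ?one)"
      by (simp only: B.scaleR_left B.diff_left real_scaleR_def)
    then show ?case using stat[of t f] elim by simp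
  qed
  then have "((\<lambda>t. ?B ((1 / t) *\<^sub>R (S t f - f)) ?one) \<longlongrightarrow> 0) (at_right 0)"
    by (rule tendsto_eventually)
  then have "?B g ?one = 0" by (rule tendsto_unique[OF trivial_limit_at_right_real lim])
  then show ?thesis by simp
qed

text \<open>
  Symmetry passes from \<open>L\<close> to its powers, to the Taylor series of \<open>S t\<close> on functions of finitely
  many sites for \<open>t < 1/8\<close>, by density to all continuous functions for these \<open>t\<close>, and by
  \<open>S (n * t) = (S t) ^ n\<close> to all times.
\<close>

lemma symmetric_generator_imp_reversible:
  assumes S: "exclusion_semigroup p q S"
    and rates: "\<And>i. 0 \<le> p i \<and> p i \<le> 1" "\<And>i. 0 \<le> q i \<and> q i \<le> 1"
    and stat: "\<mu> \<in> stationary_distributions S"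
    and sym: "\<And>f g. finitely_dependent f \<Longrightarrow> finitely_dependent g \<Longrightarrow>
      (\<integral>\<eta>. f \<eta> * exclusion_generator p q g \<eta> \<partial>\<mu>) = (\<integral>\<eta>. g \<eta> * exclusion_generator p q f \<eta> \<partial>\<mu>)"
  shows "reversible S \<mu>"
proof -
  define B where "B f g = (\<integral>\<eta>. apply_bcontfun f \<eta> * apply_bcontfun g \<eta> \<partial>\<mu>)"
    for f g :: "config \<Rightarrow>\<^sub>C real"
  have \<mu>: "prob_space \<mu>" "sets \<mu> = sets borel"
    using stat by (auto simp: stationary_distributions_def)
  interpret B: bounded_bilinear B
    unfolding B_def[abs_def] by (rule bounded_bilinear_integral_mult[OF \<mu>])
  have Bcomm: "B f g = B g f" for f g by (simp add: B_def mult.commute)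
  have M: "markov_semigroup S" using S by (simp add: exclusion_semigroup_def)
  define L where "L = generator_bcontfun p q"
  define fd where "fd f \<longleftrightarrow> finitely_dependent (apply_bcontfun f)" for f :: "config \<Rightarrow>\<^sub>C real"
  have fdL: "fd ((L ^^ k) f)" if "fd f" for k f
  proof -
    have "finitely_dependent (apply_bcontfun f)" using that by (simp add: fd_def)
    then obtain m where "depends_on (box m) (apply_bcontfun f)"
      by (rule finitely_dependentE)
    from generator_iterates(1)[OF S rates this, of k] show ?thesis
      unfolding fd_def L_def by (rule depends_on_box_imp_finitely_dependent)
  qed
  have BL: "B f (L g) = B (L f) g" if "fd f" "fd g" for f g
    using sym[of "apply_bcontfun f" "apply_bcontfun g"] that
    unfolding B_def L_def fd_def by (simp add: exclusion_semigroup_generator(1)[OF S] mult.commute)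
  have BLk: "B f ((L ^^ k) g) = B ((L ^^ k) f) g" if "fd f" "fd g" for f g k
    using that
  proof (induction k arbitrary: f)
    case (Suc k)
    have "B f ((L ^^ Suc k) g) = B (L f) ((L ^^ k) g)"
      using BL[OF Suc.prems(1) fdL[OF Suc.prems(2)]] by simp
    also have "\<dots> = B ((L ^^ k) (L f)) g"
      using Suc.IH[of "L f"] Suc.prems fdL[of f 1] by simp
    finally show ?case by (simp add: funpow_swap1)
  qed simp
  have small_fd: "B f (S t g) = B g (S t f)" if "0 \<le> t" "t < 1 / 8" "fd f" "fd g" for t f g
  proof -
    have lim: "(\<lambda>n. \<Sum>k<n. t ^ k / fact k * B u ((L ^^ k) v)) \<longlonglongrightarrow> B u (S t v)"
      if "fd v" for u v
    proof -
      have "(\<lambda>n. B u (\<Sum>k<n. (t ^ k / fact k) *\<^sub>R (L ^^ k) v)) \<longlonglongrightarrow> B u (S t v)"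
        using exclusion_semigroup_taylor_tendsto[OF S rates _ \<open>0 \<le> t\<close> \<open>t < 1 / 8\<close>, of v] \<open>fd v\<close>
        unfolding fd_def L_def by (intro B.tendsto tendsto_const) auto
      then show ?thesis by (simp add: B.sum_right B.scaleR_right)
    qed
    have "B f ((L ^^ k) g) = B g ((L ^^ k) f)" for k
      using BLk[OF that(3,4)] Bcomm by metis
    then show ?thesis
      using lim[OF that(4), of f] lim[OF that(3), of g] by (simp add: LIMSEQ_unique)
  qed
  have approx: "\<exists>u. (\<forall>n. fd (u n)) \<and> u \<longlonglongrightarrow> f" for f
  proof -
    have "\<exists>g. fd g \<and> norm (f - g) \<le> inverse (real (Suc n))" for n
      using finitely_dependent_dense[of "inverse (real (Suc n))" f] unfolding fd_def
      by (metis inverse_positive_iff_positive of_nat_0_less_iff zero_less_Suc)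
    then obtain u where u: "\<And>n. fd (u n)" "\<And>n. norm (f - u n) \<le> inverse (real (Suc n))"
      by metis
    have "(\<lambda>n. f - u n) \<longlonglongrightarrow> 0"
      by (rule Lim_null_comparison[OF always_eventually[OF allI[OF u(2)]] LIMSEQ_inverse_real_of_nat])
    from tendsto_diff[OF tendsto_const[of f] this] show ?thesis using u(1) by auto
  qed
  have small: "B f (S t g) = B g (S t f)" if t: "0 \<le> t" "t < 1 / 8" for t f g
  proof -
    obtain u v where uv: "\<And>n. fd (u n)" "u \<longlonglongrightarrow> f" "\<And>n. fd (v n)" "v \<longlonglongrightarrow> g"
      using approx[of f] approx[of g] by blast
    have "bounded_linear (S t)"
      using markov_semigroupD(1)[OF M t(1)] markov_semigroup_norm_le[OF M t(1)]
      by (intro bounded_linear_intro[where K = 1]) (auto simp: linear_add linear_scale)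
    then interpret St: bounded_linear "S t" .
    have "(\<lambda>n. B (u n) (S t (v n))) \<longlonglongrightarrow> B f (S t g)"
      "(\<lambda>n. B (v n) (S t (u n))) \<longlonglongrightarrow> B g (S t f)"
      by (intro B.tendsto St.tendsto uv)+
    then show ?thesis
      using small_fd[OF t uv(1,3)] by (simp add: LIMSEQ_unique)
  qed
  have iterate: "B f (S (real n * t) g) = B g (S (real n * t) f)"
    if t: "0 \<le> t" "t < 1 / 8" for t f g n
  proof (induction n arbitrary: f g)
    case 0
    then show ?case by (simp add: markov_semigroupD(2)[OF M] Bcomm)
  next
    case (Suc n)
    have nt: "0 \<le> real n * t" using t by simp
    have split: "S (real (Suc n) * t) h = S t (S (real n * t) h)"
      "S (real (Suc n) * t) h = S (real n * t) (S t h)" for h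
      using markov_semigroupD(3)[OF M t(1) nt, of h] markov_semigroupD(3)[OF M nt t(1), of h]
      by (simp_all add: algebra_simps)
    have "B f (S (real (Suc n) * t) g) = B (S (real n * t) g) (S t f)"
      unfolding split(1) by (rule small[OF t])
    also have "\<dots> = B (S t f) (S (real n * t) g)" by (rule Bcomm)
    also have "\<dots> = B g (S (real (Suc n) * t) f)" unfolding split(2) by (rule Suc.IH)
    finally show ?case .
  qed
  have "B f (S t g) = B g (S t f)" if "0 \<le> t" for t f g
  proof -
    obtain n where n: "8 * t < real n" using reals_Archimedean2 by blast
    then have "0 < real n" using that by linarith
    then have "t / real n < 1 / 8" "real n * (t / real n) = t" using n by (simp_all add: field_simps)
    then show ?thesis using iterate[of "t / real n" f n g] that by simp
  qed
  then show ?thesis using stat by (auto simp: reversible_def B_def)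
qed

section \<open>Reversibility of all stationary distributions\<close>

theorem corollary1:
  fixes p :: "int \<Rightarrow> real"
    and S :: "real \<Rightarrow> (config \<Rightarrow>\<^sub>C real) \<Rightarrow> (config \<Rightarrow>\<^sub>C real)"
  assumes "\<And>i. 0 < p i \<and> p i < 1"
    and "exclusion_semigroup p (\<lambda>i. 1 - p i) S"
    and "\<And>(\<epsilon>::real) (n::nat). \<epsilon> > 0 \<Longrightarrow> n > 0 \<Longrightarrow>
           \<exists>k l :: int.
             (\<forall>i. k \<le> i \<and> i \<le> k + int n \<longrightarrow> p i \<ge> 1/2 - \<epsilon>) \<and>
             (\<forall>i. l \<le> i \<and> i \<le> l + int n \<longrightarrow> p i \<le> 1/2 + \<epsilon>)"
  shows "\<forall>\<mu> \<in> stationary_distributions S. reversible S \<mu>"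
proof
  fix \<mu> assume \<mu>: "\<mu> \<in> stationary_distributions S"
  have "generator_stationary \<mu> p (\<lambda>i. 1 - p i)"
  proof (intro generator_stationary.intro generator_stationary_axioms.intro)
    show "prob_space \<mu>" "sets \<mu> = sets borel"
      using \<mu> by (auto simp: stationary_distributions_def)
    fix f :: "config \<Rightarrow> real" assume f: "finitely_dependent f"
    then obtain m where "depends_on (box m) f" by (rule finitely_dependentE)
    then have app: "apply_bcontfun (Bcontfun f) = f"
      by (rule Bcontfun_inverse[OF depends_on_bcontfun[OF finite_box]])
    show "(\<integral>\<eta>. exclusion_generator p (\<lambda>i. 1 - p i) f \<eta> \<partial>\<mu>) = 0"
      using stationary_imp_integral_generator_eq_0[OF \<mu> exclusion_semigroup_generator(2)[OF assms(2)]]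
        exclusion_semigroup_generator(1)[OF assms(2)] f app by metis
  qed (use assms(1) in \<open>auto simp: less_imp_le\<close>)
  then interpret generator_stationary \<mu> p "\<lambda>i. 1 - p i" .
  have bound: "\<bar>current i\<bar> \<le> 1 / (2 * real (Suc n)) + 1 / real (Suc n)" for i n
  proof -
    obtain k l where "\<forall>i. k \<le> i \<and> i \<le> k + int (Suc n) \<longrightarrow> p i \<ge> 1/2 - 1 / real (Suc n)"
      "\<forall>i. l \<le> i \<and> i \<le> l + int (Suc n) \<longrightarrow> p i \<le> 1/2 + 1 / real (Suc n)"
      using assms(3)[of "1 / real (Suc n)" "Suc n"] by auto
    then have "current i \<le> 1 / (2 * real (Suc n)) + 1 / real (Suc n)"
      "- (1 / (2 * real (Suc n)) + 1 / real (Suc n)) \<le> current i"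
      by (intro current_le_of_stretch[of l] current_ge_of_stretch[of k]; force)+
    then show ?thesis by linarith
  qed
  have "current i = 0" for i
  proof -
    have "(\<lambda>n. 1 / (2 * real (Suc n)) + 1 / real (Suc n)) \<longlonglongrightarrow> 0" by real_asymp
    then have "\<bar>current i\<bar> \<le> 0"
      by (rule LIMSEQ_le_const) (use bound in blast)
    then show ?thesis by simp
  qed
  then show "reversible S \<mu>"
    using assms(1)
    by (intro symmetric_generator_imp_reversible[OF assms(2) _ _ \<mu>] generator_symmetric)
      (auto simp: less_imp_le)
qed

end
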